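(* Let $\mathfrak g$ be a finite dimensional Lie algebra over a field of characteristic zero. Let $\mathfrak b\subseteq\mathfrak a\subseteq\mathfrak g$ be linear subspaces which contain $\mathrm{nil}(\mathfrak g)$, and let $\mathfrak u=\{x\in\mathfrak g : [x,\mathfrak a]\subseteq \mathfrak b\}$. Then for any admissible form on $\mathfrak g$, $\mathfrak u\cap\mathfrak u^\perp\subseteq\mathcal N(\mathfrak g)$.
   Context: All representations are finite dimensional. The \emph{nilpotent radical} $\mathrm{nil}(\mathfrak g)$ is the intersection of the kernels of all simple (irreducible) representations of $\mathfrak g$. The \emph{nilpotent cone} is $\mathcal N(\mathfrak g)=\{x\in\mathfrak g : \rho(x)$ is nilpotent for every representation $\rho$ of $\mathfrak g\}$. The trace form of a representation $\rho:\mathfrak g\to\mathfrak{gl}(V)$ is $(x,y)\mapsto\mathrm{tr}(\rho(x)\rho(y))$. An \emph{admissible form} on $\mathfrak g$ is a trace form (of some representation) with $\mathfrak g^\perp=\mathrm{nil}(\mathfrak g)$. For a subspace $\mathfrak s\subseteq\mathfrak g$, $\mathfrak s^\perp$ denotes its orthogonal space in $\mathfrak g$ with respect to the given form. *)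

theory Defs
  imports "Jordan_Normal_Form.VS_Connect"
begin

(* The underlying vector space is the whole type 'a. *)
locale lie_algebra = vector_space scale
  for scale :: "'k::field \<Rightarrow> 'a::ab_group_add \<Rightarrow> 'a" +
  fixes bracket :: "'a \<Rightarrow> 'a \<Rightarrow> 'a"
  assumes bracket_add_left: "bracket (x + y) z = bracket x z + bracket y z"
    and bracket_add_right: "bracket x (y + z) = bracket x y + bracket x z"
    and bracket_scale_left: "bracket (scale c x) y = scale c (bracket x y)"
    and bracket_scale_right: "bracket x (scale c y) = scale c (bracket x y)"
    and bracket_self: "bracket x x = 0"
    and jacobi: "bracket x (bracket y z) + bracket y (bracket z x) + bracket z (bracket x y) = 0"

(* A finite dimensional representation is given on the coordinate space k^n, for arbitrary n:
   every finite dimensional V is isomorphic to some k^n (n = 0 included), and this keeps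
   quantification over all representations inside a formula. *)
definition representation ::
  "('k::field \<Rightarrow> 'a::ab_group_add \<Rightarrow> 'a) \<Rightarrow> ('a \<Rightarrow> 'a \<Rightarrow> 'a) \<Rightarrow> nat \<Rightarrow> ('a \<Rightarrow> 'k mat) \<Rightarrow> bool"
  where "representation scale bracket n \<rho> \<longleftrightarrow>
    (\<forall>x. \<rho> x \<in> carrier_mat n n) \<and>
    (\<forall>x y. \<rho> (x + y) = \<rho> x + \<rho> y) \<and>
    (\<forall>c x. \<rho> (scale c x) = c \<cdot>\<^sub>m \<rho> x) \<and>
    (\<forall>x y. \<rho> (bracket x y) = \<rho> x * \<rho> y - \<rho> y * \<rho> x)"

(* The zero representation is not irreducible. *)
definition irreducible_representation ::
  "('k::field \<Rightarrow> 'a::ab_group_add \<Rightarrow> 'a) \<Rightarrow> ('a \<Rightarrow> 'a \<Rightarrow> 'a) \<Rightarrow> nat \<Rightarrow> ('a \<Rightarrow> 'k mat) \<Rightarrow> bool"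
  where "irreducible_representation scale bracket n \<rho> \<longleftrightarrow>
    representation scale bracket n \<rho> \<and> n > 0 \<and>
    (\<forall>W. subspace class_ring W (module_vec TYPE('k) n) \<and> (\<forall>x. \<forall>v\<in>W. \<rho> x *\<^sub>v v \<in> W)
         \<longrightarrow> W = {0\<^sub>v n} \<or> W = carrier_vec n)"

definition nilpotent_radical ::
  "('k::field \<Rightarrow> 'a::ab_group_add \<Rightarrow> 'a) \<Rightarrow> ('a \<Rightarrow> 'a \<Rightarrow> 'a) \<Rightarrow> 'a set"
  where "nilpotent_radical scale bracket =
    {x. \<forall>n \<rho>. irreducible_representation scale bracket n \<rho> \<longrightarrow> \<rho> x = 0\<^sub>m n n}"

definition nilpotent_mat :: "'k::field mat \<Rightarrow> bool"
  where "nilpotent_mat A \<longleftrightarrow> (\<exists>m. A ^\<^sub>m m = 0\<^sub>m (dim_row A) (dim_col A))"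

definition nilpotent_cone ::
  "('k::field \<Rightarrow> 'a::ab_group_add \<Rightarrow> 'a) \<Rightarrow> ('a \<Rightarrow> 'a \<Rightarrow> 'a) \<Rightarrow> 'a set"
  where "nilpotent_cone scale bracket =
    {x. \<forall>n \<rho>. representation scale bracket n \<rho> \<longrightarrow> nilpotent_mat (\<rho> x)}"

definition mat_trace :: "'k::field mat \<Rightarrow> 'k"
  where "mat_trace A = (\<Sum>i<dim_row A. A $$ (i, i))"

definition trace_form :: "('a \<Rightarrow> 'k::field mat) \<Rightarrow> 'a \<Rightarrow> 'a \<Rightarrow> 'k"
  where "trace_form \<rho> x y = mat_trace (\<rho> x * \<rho> y)"

(* Only used for symmetric forms, so left and right orthogonals agree. *)
definition orthogonal_space :: "('a \<Rightarrow> 'a \<Rightarrow> 'k::field) \<Rightarrow> 'a set \<Rightarrow> 'a set"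
  where "orthogonal_space \<beta> S = {x. \<forall>y\<in>S. \<beta> x y = 0}"

definition admissible_form ::
  "('k::field \<Rightarrow> 'a::ab_group_add \<Rightarrow> 'a) \<Rightarrow> ('a \<Rightarrow> 'a \<Rightarrow> 'a) \<Rightarrow> ('a \<Rightarrow> 'a \<Rightarrow> 'k) \<Rightarrow> bool"
  where "admissible_form scale bracket \<beta> \<longleftrightarrow>
    (\<exists>n \<rho>. representation scale bracket n \<rho> \<and> \<beta> = trace_form \<rho>) \<and>
    orthogonal_space \<beta> UNIV = nilpotent_radical scale bracket"

end

theory Submission
  imports Defs
    "Jordan_Normal_Form.Char_Poly"
    "Jordan_Normal_Form.DL_Rank"
    "HOL-Algebra.Algebraic_Closure_Type"
    "HOL-Library.Function_Algebras"
begin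

text \<open>
  This is Cartan's criterion with replicas of \<open>\<rho> x\<close> projected back to \<open>\<gg>\<close> by means of the form.
  Let \<open>\<rho>\<close> be a representation, \<open>\<lambda>\<^sub>i\<close> the eigenvalues of \<open>\<rho> x\<close> in the algebraic closure \<open>K\<close> and
  \<open>f : K \<rightarrow> \<rat>\<close> additive. Choose a polynomial \<open>q\<close> such that \<open>Y = q(\<rho> x)\<close> has the eigenvalues \<open>f(\<lambda>\<^sub>i)\<close>;
  then \<open>[Y, -] = p(ad (\<rho> x))\<close> for a polynomial \<open>p\<close> that vanishes at 0 to any prescribed order.
  The functional \<open>z \<mapsto> tr(Y \<rho> z)\<close> kills \<open>nil(\<gg>)\<close>, so after composing with a linear map \<open>K \<rightarrow> k\<close> it is
  \<open>\<beta>(y, -)\<close> for some \<open>y \<in> \<gg>\<close>, and invariance gives \<open>[y, a] \<in> span {(ad x)\<^sup>j a | j \<ge> 1} + nil(\<gg>)\<close>, hence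
  \<open>y \<in> \<uu>\<close>. So \<open>\<beta>(x, y) = 0\<close>, which yields \<open>\<Sum> f(\<lambda>\<^sub>i) \<lambda>\<^sub>i = 0\<close>; applying \<open>f\<close> gives \<open>\<Sum> f(\<lambda>\<^sub>i)\<^sup>2 = 0\<close>.
  Therefore \<open>\<rho> x\<close> is nilpotent for the representation \<open>\<rho>\<close> that defines \<open>\<beta>\<close>, and \<open>ad x\<close> is nilpotent
  modulo \<open>nil(\<gg>)\<close>. For any other representation the same argument applies with \<open>p\<close> vanishing to such
  a high order that \<open>[y, \<gg>] \<subseteq> nil(\<gg>)\<close>, so again \<open>y \<in> \<uu>\<close>.
\<close>

subsection \<open>Polynomials in commuting operators\<close>

locale polynomial_operators = vector_space scale
  for scale :: "'k::field \<Rightarrow> 'v::ab_group_add \<Rightarrow> 'v"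
begin

definition endo :: "('v \<Rightarrow> 'v) \<Rightarrow> bool"
  where "endo T \<longleftrightarrow> (\<forall>v w. T (v + w) = T v + T w) \<and> (\<forall>c v. T (scale c v) = scale c (T v))"

lemma endo_add: "endo T \<Longrightarrow> T (v + w) = T v + T w"
  by (simp add: endo_def)

lemma endo_scale: "endo T \<Longrightarrow> T (scale c v) = scale c (T v)"
  by (simp add: endo_def)

lemma endo_zero: "endo T \<Longrightarrow> T 0 = 0"
  using endo_add[of T 0 0] by simp

lemma endo_uminus: "endo T \<Longrightarrow> T (- v) = - T v"
  using endo_add[of T v "- v"] endo_zero[of T] by (simp add: eq_neg_iff_add_eq_0 add.commute)

lemma endo_diff: "endo T \<Longrightarrow> T (v - w) = T v - T w"
  using endo_add[of T v "- w"] endo_uminus[of T w] by simp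

lemma endo_sum: "endo T \<Longrightarrow> T (sum f A) = (\<Sum>i\<in>A. T (f i))"
  by (induction A rule: infinite_finite_induct) (auto simp: endo_zero endo_add)

lemma endo_diff_fun: "endo S \<Longrightarrow> endo T \<Longrightarrow> endo (\<lambda>v. S v - T v)"
  by (simp add: endo_def scale_right_diff_distrib algebra_simps)

lemma endo_shift: "endo T \<Longrightarrow> endo (\<lambda>v. T v - scale c v)"
  by (simp add: endo_def scale_right_diff_distrib scale_right_distrib scale_left_commute algebra_simps)

lemma endo_funpow: "endo T \<Longrightarrow> endo (T ^^ n)"
  by (induction n) (simp_all add: endo_def)

definition poly_op :: "('v \<Rightarrow> 'v) \<Rightarrow> 'k poly \<Rightarrow> 'v \<Rightarrow> 'v"
  where "poly_op T p v = (\<Sum>i\<le>Polynomial.degree p. scale (Polynomial.coeff p i) ((T ^^ i) v))"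

lemma poly_op_alt:
  assumes "Polynomial.degree p \<le> N"
  shows "poly_op T p v = (\<Sum>i\<le>N. scale (Polynomial.coeff p i) ((T ^^ i) v))"
  unfolding poly_op_def
  by (rule sum.mono_neutral_left) (use assms in \<open>auto simp: coeff_eq_0\<close>)

lemma endo_poly_op: "endo T \<Longrightarrow> endo (poly_op T p)"
  using endo_funpow[of T]
  by (simp add: endo_def poly_op_def scale_right_distrib sum.distrib scale_sum_right mult.commute)

lemma poly_op_add: "poly_op T (p + q) v = poly_op T p v + poly_op T q v"
proof -
  let ?N = "max (Polynomial.degree p) (Polynomial.degree q)"
  show ?thesis
    using poly_op_alt[of "p + q" ?N] poly_op_alt[of p ?N] poly_op_alt[of q ?N] degree_add_le_max[of p q]
    by (simp add: scale_left_distrib sum.distrib)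
qed

lemma poly_op_smult: "poly_op T (Polynomial.smult c p) v = scale c (poly_op T p v)"
  using poly_op_alt[of "Polynomial.smult c p" "Polynomial.degree p" T v]
  by (simp add: poly_op_def scale_sum_right degree_smult_le)

lemma poly_op_diff: "poly_op T (p - q) v = poly_op T p v - poly_op T q v"
  using poly_op_add[of T p "Polynomial.smult (-1) q" v] poly_op_smult[of T "-1" q v] by simp

lemma poly_op_const [simp]: "poly_op T [:c:] v = scale c v"
  by (simp add: poly_op_def)

lemma poly_op_0 [simp]: "poly_op T 0 v = 0"
  by (simp add: poly_op_def)

lemma poly_op_1 [simp]: "poly_op T 1 v = v"
  by (simp add: poly_op_def)

lemma poly_op_pCons:
  assumes "endo T"
  shows "poly_op T (pCons a p) v = scale a v + T (poly_op T p v)"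
proof -
  have "poly_op T (pCons a p) v = (\<Sum>i\<le>Suc (Polynomial.degree p). scale (Polynomial.coeff (pCons a p) i) ((T ^^ i) v))"
    by (rule poly_op_alt) (simp add: degree_pCons_le)
  then show ?thesis
    using assms by (simp add: sum.atMost_Suc_shift poly_op_def endo_sum endo_scale del: sum.atMost_Suc)
qed

lemma poly_op_mult:
  assumes "endo T"
  shows "poly_op T (p * q) v = poly_op T p (poly_op T q v)"
  by (induction p) (simp_all add: poly_op_add poly_op_smult poly_op_pCons[OF assms])

lemma poly_op_linear:
  assumes "endo T"
  shows "poly_op T [:- c, 1:] v = T v - scale c v"
  using assms by (simp add: poly_op_pCons endo_zero endo_add)

lemma poly_op_linear_power:
  assumes "endo T"
  shows "poly_op T ([:- c, 1:] ^ n) v = ((\<lambda>v. T v - scale c v) ^^ n) v"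
proof (induction n)
  case (Suc n)
  then show ?case
    by (simp only: power_Suc poly_op_mult[OF assms] poly_op_linear[OF assms] funpow.simps o_apply)
qed simp

lemma poly_op_commute:
  assumes "endo S" and ST: "\<And>v. S (T v) = T (S v)"
  shows "poly_op T p (S v) = S (poly_op T p v)"
proof -
  have "(T ^^ i) (S v) = S ((T ^^ i) v)" for i
    by (induction i) (simp_all add: ST)
  then show ?thesis
    using assms(1) by (simp add: poly_op_def endo_sum endo_scale)
qed

lemma poly_op_dvd_zero:
  assumes "endo T" "p dvd q" "poly_op T p v = 0"
  shows "poly_op T q v = 0"
proof -
  obtain r where "q = r * p"
    using assms(2) by (metis dvdE mult.commute)
  then show ?thesis
    using assms endo_zero[OF endo_poly_op] by (simp add: poly_op_mult)
qed

lemma poly_op_eq_const: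
  assumes "endo T" "p dvd q - [:c:]" "poly_op T p v = 0"
  shows "poly_op T q v = scale c v"
  using poly_op_dvd_zero[OF assms] by (simp add: poly_op_diff)

text \<open>For the difference D, D^(m+1) w = D^m (A w) - D^m (B w), and passing to
  \<open>A w\<close> or \<open>B w\<close> lowers one of the two exponents; induction on
  \<open>a + b\<close> thus replaces the binomial theorem. Annihilation is assumed at the single
  vector \<open>w\<close> only, so that it can be used on generalised eigenvectors.\<close>

lemma funpow_diff_eq_zero:
  assumes A: "endo A" and B: "endo B" and AB: "\<And>v. A (B v) = B (A v)"
    and "(A ^^ a) w = 0" "(B ^^ b) w = 0"
  shows "((\<lambda>v. A v - B v) ^^ (a + b)) w = 0"
  using assms(4,5)
proof (induction "a + b" arbitrary: a b w)
  case 0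
  then show ?case by simp
next
  case (Suc m)
  let ?D = "\<lambda>v. A v - B v"
  have D: "endo (?D ^^ k)" for k
    by (intro endo_funpow endo_diff_fun A B)
  have comm_A: "(B ^^ k) (A v) = A ((B ^^ k) v)" for k v
    by (induction k) (simp_all add: AB)
  have comm_B: "(A ^^ k) (B v) = B ((A ^^ k) v)" for k v
    by (induction k) (simp_all add: AB)
  show ?case
  proof (cases "a = 0 \<or> b = 0")
    case True
    then have "w = 0" using Suc.prems by auto
    then show ?thesis using endo_zero[OF D] by simp
  next
    case False
    then obtain a' b' where ab: "a = Suc a'" "b = Suc b'"
      by (metis not0_implies_Suc)
    have m: "m = a' + b" "m = a + b'"
      using Suc.hyps(2) ab by auto
    have "(?D ^^ (a' + b)) (A w) = 0"
    proof (rule Suc.hyps(1)[OF m(1)])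
      show "(A ^^ a') (A w) = 0"
        using Suc.prems(1) by (simp only: ab funpow_Suc_right o_apply)
      show "(B ^^ b) (A w) = 0"
        using Suc.prems(2) by (simp add: comm_A endo_zero[OF A])
    qed
    moreover have "(?D ^^ (a + b')) (B w) = 0"
    proof (rule Suc.hyps(1)[OF m(2)])
      show "(A ^^ a) (B w) = 0"
        using Suc.prems(1) by (simp add: comm_B endo_zero[OF B])
      show "(B ^^ b') (B w) = 0"
        using Suc.prems(2) by (simp only: ab funpow_Suc_right o_apply)
    qed
    ultimately have "(?D ^^ m) (A w - B w) = 0"
      using endo_diff[OF D] by (simp only: m[symmetric] diff_self)
    then show ?thesis
      unfolding Suc.hyps(2)[symmetric] by (simp only: funpow_Suc_right o_apply)
  qed
qed

end

text \<open>The witness is 1 - h^N with h = 1 - c g, where g is the product of the powers over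
  \<open>S\<close> and \<open>c\<close> makes h vanish at \<open>l\<close>. Then X - l divides h,
  and the geometric sum shows that 1 - h, a multiple of g, divides 1 - h^N.\<close>

lemma linear_power_idempotent:
  fixes l :: "'a::field"
  assumes "finite S" "l \<notin> S"
  shows "\<exists>e. (\<Prod>m\<in>S. [:- m, 1:] ^ N) dvd e \<and> [:- l, 1:] ^ N dvd 1 - e"
proof -
  define g where "g = (\<Prod>m\<in>S. [:- m, 1:] ^ N)"
  define c where "c = inverse (poly g l)"
  have gl: "poly g l \<noteq> 0"
    using assms by (auto simp: g_def poly_prod prod_zero_iff)
  define h where "h = 1 - Polynomial.smult c g"
  have "poly h l = 0"
    using gl by (simp add: h_def c_def)
  then have "[:- l, 1:] ^ N dvd h ^ N"
    by (simp add: poly_eq_0_iff_dvd dvd_power_same)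
  moreover have "1 - h dvd 1 - h ^ N"
  proof -
    have "(1 - h) * (\<Sum>i<N. h ^ i) = 1 - h ^ N"
      by (rule one_diff_power_eq[symmetric])
    then show ?thesis by (metis dvd_triv_left)
  qed
  then have "g dvd 1 - h ^ N"
    using dvd_trans[of g "1 - h"] by (simp add: h_def dvd_smult)
  ultimately show ?thesis
    unfolding g_def[symmetric] by (intro exI[of _ "1 - h ^ N"]) simp
qed

text \<open>Chinese remaindering, one node at a time: the correction
  \<open>e * ([:f l:] - p)\<close> installs the value at the new node, where \<open>e\<close> is
  congruent to 1, and changes nothing at the old nodes, where \<open>e\<close> is congruent to
  0.\<close>

lemma linear_power_interpolation:
  fixes f :: "'a::field \<Rightarrow> 'a"
  assumes "finite S"
  shows "\<exists>p. \<forall>l\<in>S. [:- l, 1:] ^ N dvd p - [:f l:]"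
  using assms
proof induction
  case empty
  then show ?case by simp
next
  case (insert l S)
  then obtain p where p: "\<And>m. m \<in> S \<Longrightarrow> [:- m, 1:] ^ N dvd p - [:f m:]"
    by blast
  obtain e where e: "(\<Prod>m\<in>S. [:- m, 1:] ^ N) dvd e" "[:- l, 1:] ^ N dvd 1 - e"
    using linear_power_idempotent[OF insert.hyps] by blast
  define p' where "p' = p + e * ([:f l:] - p)"
  have "p + e * (c - p) - c = (1 - e) * (p - c)" for c
    by (simp add: algebra_simps)
  then have "p' - [:f l:] = (1 - e) * (p - [:f l:])"
    by (simp only: p'_def)
  then have "[:- l, 1:] ^ N dvd p' - [:f l:]"
    using e(2) by simp
  moreover have "[:- m, 1:] ^ N dvd p' - [:f m:]" if "m \<in> S" for m
  proof -
    have "[:- m, 1:] ^ N dvd e"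
      using e(1) dvd_prodI[OF insert.hyps(1) that, of "\<lambda>m. [:- m, 1:] ^ N"] dvd_trans by blast
    then have "[:- m, 1:] ^ N dvd (p - [:f m:]) + e * ([:f l:] - p)"
      using p[OF that] by (intro dvd_add) auto
    then show ?thesis by (simp add: p'_def algebra_simps)
  qed
  ultimately show ?case by blast
qed

section \<open>Primary decomposition and differences of commuting operators\<close>

context polynomial_operators
begin

text \<open>Each idempotent splits off one generalised eigenspace. The components are polynomials in
  \<open>T\<close> applied to \<open>v\<close>, so whatever a commuting operator annihilates in
  \<open>v\<close> it also annihilates in them; this permits a second decomposition for another
  operator.\<close>

lemma primary_decomposition:
  assumes T: "endo T" and "finite S"
    and "poly_op T (\<Prod>l\<in>S. [:- l, 1:] ^ N) v = 0"
  shows "\<exists>e. v = (\<Sum>l\<in>S. poly_op T (e l) v) \<and>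
    (\<forall>l\<in>S. poly_op T ([:- l, 1:] ^ N) (poly_op T (e l) v) = 0)"
  using assms(2,3)
proof (induction arbitrary: v)
  case empty
  then show ?case by simp
next
  case (insert l S)
  let ?g = "\<Prod>m\<in>S. [:- m, 1:] ^ N"
  obtain e where e: "?g dvd e" "[:- l, 1:] ^ N dvd 1 - e"
    using linear_power_idempotent[OF insert.hyps] by blast
  have prod: "poly_op T ([:- l, 1:] ^ N * ?g) v = 0"
    using insert.prems insert.hyps by simp
  have 1: "poly_op T ([:- l, 1:] ^ N) (poly_op T e v) = 0"
    using poly_op_dvd_zero[OF T _ prod] e(1) poly_op_mult[OF T, symmetric] by (simp add: mult_dvd_mono)
  have "poly_op T ?g (poly_op T (1 - e) v) = 0"
    using poly_op_dvd_zero[OF T _ prod] e(2) poly_op_mult[OF T, symmetric]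
    by (simp add: mult_dvd_mono mult.commute[of ?g])
  from insert.IH[OF this] obtain u where
    u: "poly_op T (1 - e) v = (\<Sum>m\<in>S. poly_op T (u m) (poly_op T (1 - e) v))"
      "\<And>m. m \<in> S \<Longrightarrow> poly_op T ([:- m, 1:] ^ N) (poly_op T (u m) (poly_op T (1 - e) v)) = 0"
    by blast
  \<comment> \<open>The induction hypothesis decomposes \<open>poly_op T (1 - e) v\<close>; the
    factor \<open>1 - e\<close> rewrites its components as polynomials in \<open>T\<close> applied
    to \<open>v\<close> itself.\<close>
  define e' where "e' m = (if m = l then e else u m * (1 - e))" for m
  have S: "poly_op T (e' m) v = poly_op T (u m) (poly_op T (1 - e) v)" if "m \<in> S" for m
    using that insert.hyps by (auto simp: e'_def poly_op_mult[OF T])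
  have "v = poly_op T e v + poly_op T (1 - e) v"
    by (simp add: poly_op_diff)
  then have "v = poly_op T (e' l) v + (\<Sum>m\<in>S. poly_op T (e' m) v)"
    using u(1) S by (simp add: e'_def)
  then have "v = (\<Sum>m\<in>insert l S. poly_op T (e' m) v)"
    using insert.hyps by simp
  moreover have "\<forall>m\<in>insert l S. poly_op T ([:- m, 1:] ^ N) (poly_op T (e' m) v) = 0"
    using 1 u(2) S by (auto simp: e'_def)
  ultimately show ?case by blast
qed

text \<open>On a generalised eigenvector of \<open>L\<close> for l and of \<open>R\<close> for m,
  the operator L - R has the single generalised eigenvalue l - m, so both sides act as the scalar f
  l - f m. Decomposing \<open>v\<close> first for \<open>L\<close>, then for \<open>R\<close>,
  reduces to this case. The exponent \<open>N + N\<close> is the sum of the nilpotency exponents of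
  the two commuting parts.\<close>

lemma poly_op_difference:
  assumes L: "endo L" and R: "endo R" and LR: "\<And>v. L (R v) = R (L v)"
    and fin: "finite S"
    and Lv: "poly_op L (\<Prod>l\<in>S. [:- l, 1:] ^ N) v = 0"
    and Rv: "poly_op R (\<Prod>l\<in>S. [:- l, 1:] ^ N) v = 0"
    and q: "\<And>l. l \<in> S \<Longrightarrow> [:- l, 1:] ^ N dvd q - [:f l:]"
    and p: "\<And>l m. l \<in> S \<Longrightarrow> m \<in> S \<Longrightarrow> [:- (l - m), 1:] ^ (N + N) dvd p - [:f l - f m:]"
  shows "poly_op L q v - poly_op R q v = poly_op (\<lambda>v. L v - R v) p v"
proof -
  let ?D = "\<lambda>v. L v - R v"
  have D: "endo ?D"
    by (intro endo_diff_fun L R)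
  have comm: "poly_op L r (poly_op R s w) = poly_op R s (poly_op L r w)" for r s w
    by (intro poly_op_commute endo_poly_op R poly_op_commute[of L R, symmetric] L LR)
  define P where "P w \<longleftrightarrow> poly_op L q w - poly_op R q w = poly_op ?D p w" for w
  have P_sum: "P (\<Sum>i\<in>I. g i)" if "\<And>i. i \<in> I \<Longrightarrow> P (g i)" for g and I :: "'k set"
    using that unfolding P_def
    by (simp add: endo_sum[OF endo_poly_op] L R D sum_subtractf[symmetric])
  have P_joint: "P w" if "l \<in> S" "m \<in> S" and Lw: "poly_op L ([:- l, 1:] ^ N) w = 0"
    and Rw: "poly_op R ([:- m, 1:] ^ N) w = 0" for l m w
  proof -
    have 1: "((\<lambda>v. (L v - scale l v) - (R v - scale m v)) ^^ (N + N)) w = 0"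
    proof (rule funpow_diff_eq_zero)
      show "L (R v - scale m v) - scale l (R v - scale m v) = R (L v - scale l v) - scale m (L v - scale l v)" for v
        by (simp add: endo_diff[OF L] endo_diff[OF R] endo_scale[OF L] endo_scale[OF R] LR
            scale_right_diff_distrib mult.commute)
    qed (use Lw Rw endo_shift L R poly_op_linear_power in auto)
    have 2: "(\<lambda>v. (L v - scale l v) - (R v - scale m v)) = (\<lambda>v. ?D v - scale (l - m) v)"
      by (simp add: fun_eq_iff scale_left_diff_distrib)
    have "poly_op ?D ([:- (l - m), 1:] ^ (N + N)) w = 0"
      using 1 unfolding 2 poly_op_linear_power[OF D] .
    then have "poly_op ?D p w = scale (f l - f m) w"
      using poly_op_eq_const[OF D p] that by blast
    moreover have "poly_op L q w = scale (f l) w" "poly_op R q w = scale (f m) w"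
      using poly_op_eq_const[OF L q Lw] poly_op_eq_const[OF R q Rw] that by auto
    ultimately show ?thesis
      by (simp add: P_def scale_left_diff_distrib)
  qed
  have P_left: "P w" if l: "l \<in> S" and Lw: "poly_op L ([:- l, 1:] ^ N) w = 0"
    and Rw: "poly_op R (\<Prod>l\<in>S. [:- l, 1:] ^ N) w = 0" for l w
  proof -
    obtain e where e: "w = (\<Sum>m\<in>S. poly_op R (e m) w)"
        "\<And>m. m \<in> S \<Longrightarrow> poly_op R ([:- m, 1:] ^ N) (poly_op R (e m) w) = 0"
      using primary_decomposition[OF R fin Rw] by blast
    \<comment> \<open>The components for \<open>R\<close> are polynomials in \<open>R\<close>
      applied to \<open>w\<close>; since \<open>R\<close> commutes with \<open>L\<close>, they stay
      in the generalised eigenspace of \<open>L\<close> that contains \<open>w\<close>.\<close>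
    have "poly_op L ([:- l, 1:] ^ N) (poly_op R (e m) w) = 0" for m
      using Lw by (simp add: comm endo_zero[OF endo_poly_op[OF R]])
    then have "P (\<Sum>m\<in>S. poly_op R (e m) w)"
      using P_joint[OF l] e(2) by (intro P_sum) blast
    then show ?thesis using e(1) by simp
  qed
  obtain e where e: "v = (\<Sum>m\<in>S. poly_op L (e m) v)"
      "\<And>m. m \<in> S \<Longrightarrow> poly_op L ([:- m, 1:] ^ N) (poly_op L (e m) v) = 0"
    using primary_decomposition[OF L fin Lv] by blast
  have "poly_op R (\<Prod>l\<in>S. [:- l, 1:] ^ N) (poly_op L (e m) v) = 0" for m
    using Rv by (simp add: comm[symmetric] endo_zero[OF endo_poly_op[OF L]])
  then have "P (\<Sum>m\<in>S. poly_op L (e m) v)"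
    using P_left e(2) by (intro P_sum) blast
  then show ?thesis using e(1) by (simp add: P_def)
qed

end

subsection \<open>Block triangular form, eigenvalues and traces\<close>

lemma mat_trace_add:
  assumes "A \<in> carrier_mat n n" "B \<in> carrier_mat n n"
  shows "mat_trace (A + B) = mat_trace A + mat_trace B"
  using assms by (simp add: mat_trace_def sum.distrib)

lemma mat_trace_diff:
  assumes "A \<in> carrier_mat n n" "B \<in> carrier_mat n n"
  shows "mat_trace (A - B) = mat_trace A - mat_trace B"
  using assms by (simp add: mat_trace_def sum_subtractf)

lemma mat_trace_smult: "A \<in> carrier_mat n n \<Longrightarrow> mat_trace (c \<cdot>\<^sub>m A) = c * mat_trace A"
  by (simp add: mat_trace_def sum_distrib_left)

lemma mat_trace_zero [simp]: "mat_trace (0\<^sub>m n n) = 0"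
  by (simp add: mat_trace_def)

lemma mat_trace_mult:
  assumes "A \<in> carrier_mat n m" "B \<in> carrier_mat m n"
  shows "mat_trace (A * B) = (\<Sum>i<n. \<Sum>j<m. A $$ (i, j) * B $$ (j, i))"
  using assms by (simp add: mat_trace_def scalar_prod_def atLeast0LessThan)

lemma mat_trace_comm:
  assumes "A \<in> carrier_mat n m" "B \<in> carrier_mat m n"
  shows "mat_trace (A * B) = mat_trace (B * A)"
  unfolding mat_trace_mult[OF assms] mat_trace_mult[OF assms(2,1)]
  by (subst sum.swap) (simp add: mult.commute)

lemma mat_trace_similar:
  assumes "P \<in> carrier_mat n n" "Q \<in> carrier_mat n n" "A \<in> carrier_mat n n" "P * Q = 1\<^sub>m n"
  shows "mat_trace (Q * A * P) = mat_trace A"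
proof -
  have "mat_trace (Q * A * P) = mat_trace (P * (Q * A))"
    using assms by (intro mat_trace_comm[of _ n n]) auto
  also have "P * (Q * A) = A"
    using assms by (simp flip: assoc_mult_mat[of P n n Q n A n])
  finally show ?thesis .
qed

lemma mat_trace_four_block:
  assumes A: "A \<in> carrier_mat n n" and D: "D \<in> carrier_mat m m"
  shows "mat_trace (four_block_mat A B C D) = mat_trace A + mat_trace D"
proof -
  define f where "f i = four_block_mat A B C D $$ (i, i)" for i
  have "mat_trace (four_block_mat A B C D) = sum f {0..<n + m}"
    using A D by (simp add: mat_trace_def f_def lessThan_atLeast0)
  also have "\<dots> = sum f {0..<n} + sum f {0 + n..<m + n}"
    using sum.atLeastLessThan_concat[of 0 n "n + m" f] by (simp add: add.commute[of m n])
  also have "sum f {0 + n..<m + n} = (\<Sum>i = 0..<m. f (i + n))"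
    by (rule sum.shift_bounds_nat_ivl)
  finally show ?thesis
    using A D by (simp add: mat_trace_def f_def lessThan_atLeast0)
qed

section \<open>Similarity and block triangular matrices\<close>

lemma similar_mult:
  fixes P :: "'a::comm_ring_1 mat"
  assumes c: "P \<in> carrier_mat n n" "Q \<in> carrier_mat n n" "A \<in> carrier_mat n n" "B \<in> carrier_mat n n"
    and PQ: "P * Q = 1\<^sub>m n"
  shows "Q * (A * B) * P = (Q * A * P) * (Q * B * P)"
proof -
  have "(Q * A * P) * (Q * B * P) = Q * A * (P * Q) * (B * P)"
    using c by (simp add: assoc_mult_mat[of _ n n _ n _ n])
  also have "\<dots> = Q * A * (B * P)"
    using c by (simp add: PQ right_mult_one_mat[of "Q * A" n n])
  also have "\<dots> = Q * (A * B) * P"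
    using c by (simp add: assoc_mult_mat[of _ n n _ n _ n])
  finally show ?thesis by simp
qed

lemma similar_pow:
  fixes P :: "'a::comm_ring_1 mat"
  assumes c: "P \<in> carrier_mat n n" "Q \<in> carrier_mat n n" "A \<in> carrier_mat n n"
    and PQ: "P * Q = 1\<^sub>m n" "Q * P = 1\<^sub>m n"
  shows "Q * (A ^\<^sub>m k) * P = (Q * A * P) ^\<^sub>m k"
proof (induction k)
  case 0
  then show ?case using assms by simp
next
  case (Suc k)
  then show ?case using assms by (simp add: similar_mult[of P n Q])
qed

lemma block_upper_mult:
  assumes "A \<in> carrier_mat n n" "B \<in> carrier_mat n m" "D \<in> carrier_mat m m"
    "A' \<in> carrier_mat n n" "B' \<in> carrier_mat n m" "D' \<in> carrier_mat m m"
  shows "four_block_mat A B (0\<^sub>m m n) D * four_block_mat A' B' (0\<^sub>m m n) D' =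
    four_block_mat (A * A') (A * B' + B * D') (0\<^sub>m m n) (D * D')"
  using assms by (subst mult_four_block_mat[of _ n n _ m _ m _ _ n _ m]) auto

lemma block_upper_pow:
  assumes A: "A \<in> carrier_mat n n" and B: "B \<in> carrier_mat n m" and D: "D \<in> carrier_mat m m"
  shows "\<exists>B'\<in>carrier_mat n m. four_block_mat A B (0\<^sub>m m n) D ^\<^sub>m k =
    four_block_mat (A ^\<^sub>m k) B' (0\<^sub>m m n) (D ^\<^sub>m k)"
proof (induction k)
  case 0
  then show ?case using A D by (intro bexI[of _ "0\<^sub>m n m"]) auto
next
  case (Suc k)
  then obtain B' where "B' \<in> carrier_mat n m"
    "four_block_mat A B (0\<^sub>m m n) D ^\<^sub>m k = four_block_mat (A ^\<^sub>m k) B' (0\<^sub>m m n) (D ^\<^sub>m k)"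
    by blast
  then show ?case
    using A B D by (intro bexI[of _ "A ^\<^sub>m k * B + B' * D"]) (auto simp: block_upper_mult)
qed

text \<open>A basis of \<open>W\<close> extended to the whole space gives the columns of
  \<open>P\<close>. The same \<open>P\<close> serves every \<open>A\<close> that leaves
  \<open>W\<close> invariant, so all operators of a representation are triangularised at
  once.\<close>

lemma (in vec_space) block_triangularization:
  assumes W: "VectorSpace.subspace class_ring W V"
    and W0: "W \<noteq> {0\<^sub>v n}" and W1: "W \<noteq> carrier_vec n"
  shows "\<exists>P Q d. P \<in> carrier_mat n n \<and> Q \<in> carrier_mat n n \<and> P * Q = 1\<^sub>m n \<and> Q * P = 1\<^sub>m n \<and>
    0 < d \<and> d < n \<and>
    (\<forall>A\<in>carrier_mat n n. (\<forall>v\<in>W. A *\<^sub>v v \<in> W) \<longrightarrow>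
      (\<exists>B1\<in>carrier_mat d d. \<exists>B2\<in>carrier_mat d (n - d). \<exists>B4\<in>carrier_mat (n - d) (n - d).
        Q * A * P = four_block_mat B1 B2 (0\<^sub>m (n - d) d) B4))"
proof -
  have Wsub: "LinearCombinations.submodule class_ring W V"
    using W by (rule is_module)
  have Wc: "W \<subseteq> carrier_vec n"
    using submodule.subset[OF Wsub] by simp
  have W_zero: "0\<^sub>v n \<in> W"
    using Wsub unfolding submodule_def by simp
  have fin_li: "finite S \<and> card S \<le> n" if "S \<subseteq> carrier_vec n" "lin_indpt S" for S
    using li_le_dim[OF fin_dim that] dim_is_n by simp
  obtain S where S: "finite S" "maximal S (\<lambda>S. S \<subseteq> W \<and> lin_indpt S)"
  proof -
    have "lin_indpt {}"
      by (simp add: lindep_span)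
    then show ?thesis
      using maximal_exists[of "\<lambda>S. S \<subseteq> W \<and> lin_indpt S" n "{}"] fin_li Wc that
      by (meson empty_subsetI subset_trans)
  qed
  then have SW: "S \<subseteq> W" and Sli: "lin_indpt S"
    and Smax: "\<And>S'. S \<subseteq> S' \<Longrightarrow> S' \<subseteq> W \<Longrightarrow> lin_indpt S' \<Longrightarrow> S' = S"
    unfolding maximal_def by auto
  have Sc: "S \<subseteq> carrier_vec n"
    using SW Wc by blast
  have span_S: "span S = W"
  proof
    show "span S \<subseteq> W"
      using span_is_subset[OF SW Wsub] .
    show "W \<subseteq> span S"
    proof
      fix w assume w: "w \<in> W"
      show "w \<in> span S"
      proof (cases "w \<in> S")
        case True
        then show ?thesis using in_own_span[OF Sc] by blast
      next
        case False
        then have "lin_dep (S \<union> {w})"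
          using Smax[of "S \<union> {w}"] SW w by blast
        then show ?thesis
          using lin_dep_iff_in_span[OF Sc Sli _ False] w Wc by blast
      qed
    qed
  qed
  obtain T where T: "finite T" "maximal T (\<lambda>T. S \<subseteq> T \<and> T \<subseteq> carrier_vec n \<and> lin_indpt T)"
    using maximal_exists[of "\<lambda>T. S \<subseteq> T \<and> T \<subseteq> carrier_vec n \<and> lin_indpt T" n S] fin_li Sc Sli by blast
  then have ST: "S \<subseteq> T" and Tc: "T \<subseteq> carrier_vec n" and Tli: "lin_indpt T"
    unfolding maximal_def by auto
  have "maximal T (\<lambda>S. S \<subseteq> carrier_vec n \<and> lin_indpt S)"
    using T(2) unfolding maximal_def by (meson subset_trans)
  then have basis: "basis T"
    by (rule max_li_is_basis)
  then have cardT: "card T = n"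
    using dim_basis[OF T(1)] dim_is_n by simp
  obtain us where us: "set us = S" "distinct us"
    using finite_distinct_list[OF S(1)] by blast
  obtain ws where ws: "set ws = T - S" "distinct ws"
    using finite_distinct_list[of "T - S"] T(1) by blast
  define xs where "xs = us @ ws"
  define d where "d = length us"
  have xs: "set xs = T" "distinct xs"
    using us ws ST by (auto simp: xs_def)
  have len: "length xs = n"
    using distinct_card[OF xs(2)] xs(1) cardT by simp
  have xs_us: "xs ! i \<in> S" if "i < d" for i
    using that us by (auto simp: xs_def d_def nth_append)
  \<comment> \<open>\<open>W\<close> is neither zero nor everything, which gives 0 < d < n: both
    diagonal blocks are strictly smaller, as inductions on the dimension require.\<close>
  have "S \<noteq> {}"
    using span_S W0 span_empty by auto
  then have d0: "0 < d"
    using us by (auto simp: d_def)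
  have "S \<noteq> T"
    using span_S W1 basis unfolding basis_def by auto
  then have "ws \<noteq> []"
    using ws ST by auto
  then have dn: "d < n"
    using len by (auto simp: xs_def d_def)
  define P where "P = mat_of_cols n xs"
  have P: "P \<in> carrier_mat n n"
    using len mat_of_cols_carrier(1)[of n xs] by (simp add: P_def)
  have cols_P: "cols P = xs"
    unfolding P_def using xs(1) Tc by (intro cols_mat_of_cols) simp
  have "rank P = n"
    using lin_indpt_full_rank[OF P] cols_P xs Tli by simp
  then have "det P \<noteq> 0"
    using det_rank_iff[OF P] by simp
  then have "P \<in> Units (ring_mat TYPE('a) n ())"
    by (rule det_non_zero_imp_unit[OF P])
  then obtain Q where Q: "Q \<in> carrier_mat n n" "P * Q = 1\<^sub>m n" "Q * P = 1\<^sub>m n"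
    unfolding Units_def by (auto simp: ring_mat_def)
  have colP: "col P j = xs ! j" if "j < n" for j
    using that cols_P cols_nth[of j P] P by simp
  have Qxs: "Q *\<^sub>v (xs ! j) = unit_vec n j" if "j < n" for j
    using col_mult2[OF Q(1) P that] colP[OF that] Q(3) that by simp
  \<comment> \<open>In the coordinates given by \<open>Q\<close> this is the span of the first
    \<open>d\<close> basis vectors. That it contains \<open>W\<close> is what produces the zero
    block.\<close>
  define N where "N = {v \<in> carrier_vec n. \<forall>i. d \<le> i \<longrightarrow> i < n \<longrightarrow> (Q *\<^sub>v v) $ i = 0}"
  have "LinearCombinations.submodule class_ring N V"
    unfolding submodule_def
  proof (intro conjI allI impI)
    show "Module.module class_ring V" by (rule module_axioms)
    show "N \<subseteq> carrier V" by (auto simp: N_def)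
    show "v \<oplus>\<^bsub>V\<^esub> w \<in> N" if "v \<in> N" "w \<in> N" for v w
      using that Q(1) by (auto simp: N_def scalar_prod_add_distrib[of _ n])
    show "\<zero>\<^bsub>V\<^esub> \<in> N" using Q(1) by (auto simp: N_def)
    show "c \<odot>\<^bsub>V\<^esub> v \<in> N" if "v \<in> N" for c v
      using that Q(1) by (auto simp: N_def mult_mat_vec)
  qed
  moreover have "S \<subseteq> N"
  proof
    fix s assume s: "s \<in> S"
    then obtain j where j: "j < d" "s = xs ! j"
      using us unfolding xs_def d_def by (metis in_set_conv_nth nth_append)
    then have "Q *\<^sub>v s = unit_vec n j"
      using Qxs dn by simp
    then show "s \<in> N"
      using s Sc j dn by (auto simp: N_def)
  qed
  ultimately have WN: "W \<subseteq> N"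
    using span_is_subset span_S by blast
  have "\<exists>B1\<in>carrier_mat d d. \<exists>B2\<in>carrier_mat d (n - d). \<exists>B4\<in>carrier_mat (n - d) (n - d).
        Q * A * P = four_block_mat B1 B2 (0\<^sub>m (n - d) d) B4"
    if A: "A \<in> carrier_mat n n" and inv: "\<forall>v\<in>W. A *\<^sub>v v \<in> W" for A
  proof -
    let ?C = "Q * A * P"
    have C: "?C \<in> carrier_mat n n"
      using A P Q by simp
    \<comment> \<open>Column \<open>j\<close> of the conjugated matrix lists the
      \<open>Q\<close>-coordinates of \<open>A *\<^sub>v (xs ! j)\<close>, which lies in
      \<open>W\<close>.\<close>
    have zero: "?C $$ (i, j) = 0" if i: "d \<le> i" "i < n" and j: "j < d" for i j
    proof -
      have jn: "j < n" using j dn by simp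
      have "A *\<^sub>v (xs ! j) \<in> N"
        using xs_us[OF j] SW inv WN by blast
      then have "(Q *\<^sub>v (A *\<^sub>v (xs ! j))) $ i = 0"
        using i by (simp add: N_def)
      moreover have "col ?C j = Q *\<^sub>v (A *\<^sub>v (xs ! j))"
        using assoc_mult_mat[OF Q(1) A P] col_mult2[OF Q(1) mult_carrier_mat[OF A P] jn]
          col_mult2[OF A P jn] colP[OF jn] by simp
      moreover have "col ?C j $ i = ?C $$ (i, j)"
        by (rule index_col) (use P Q(1) i jn in auto)
      ultimately show ?thesis by simp
    qed
    obtain B1 B2 B3 B4 where s: "split_block ?C d d = (B1, B2, B3, B4)"
      by (metis prod_cases4)
    have dims: "dim_row ?C = d + (n - d)" "dim_col ?C = d + (n - d)"
      using C dn by auto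
    note B = split_block[OF s dims]
    have B3_eq: "B3 = mat (dim_row ?C - d) d (\<lambda>(i, j). ?C $$ (i + d, j))"
      using s unfolding split_block_def Let_def by (simp only: prod.inject)
    have B3_zero: "B3 = 0\<^sub>m (n - d) d"
    proof (rule eq_matI)
      fix i j assume "i < dim_row (0\<^sub>m (n - d) d :: 'a mat)" "j < dim_col (0\<^sub>m (n - d) d :: 'a mat)"
      then have ij: "i < n - d" "j < d" by auto
      then have "B3 $$ (i, j) = ?C $$ (i + d, j)"
        unfolding B3_eq carrier_matD[OF C] by (simp only: index_mat prod.case)
      also have "\<dots> = 0"
        using ij by (intro zero) auto
      finally show "B3 $$ (i, j) = 0\<^sub>m (n - d) d $$ (i, j)"
        using ij by simp
    qed (use B(3) in auto)
    show ?thesis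
      by (intro bexI[OF _ B(1)] bexI[OF _ B(2)] bexI[OF _ B(4)]) (use B(5) in \<open>simp only: B3_zero\<close>)
  qed
  then show ?thesis
    using P Q d0 dn by (intro exI[of _ P] exI[of _ Q] exI[of _ d]) simp
qed

section \<open>Annihilating products of linear factors and eigenvalue lists\<close>

definition linear_factors_product :: "'a::comm_ring_1 mat \<Rightarrow> 'a list \<Rightarrow> 'a mat"
  where "linear_factors_product A es =
    foldr (\<lambda>e M. (A - e \<cdot>\<^sub>m 1\<^sub>m (dim_row A)) * M) es (1\<^sub>m (dim_row A))"

lemma linear_factors_product_Nil [simp]: "linear_factors_product A [] = 1\<^sub>m (dim_row A)"
  by (simp add: linear_factors_product_def)

lemma linear_factors_product_Cons:
  "A \<in> carrier_mat n n \<Longrightarrow>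
    linear_factors_product A (e # es) = (A - e \<cdot>\<^sub>m 1\<^sub>m n) * linear_factors_product A es"
  by (simp add: linear_factors_product_def)

lemma linear_factors_product_carrier [simp]:
  "A \<in> carrier_mat n n \<Longrightarrow> linear_factors_product A es \<in> carrier_mat n n"
  by (induction es) (auto simp: linear_factors_product_Cons[of A n])

lemma linear_factors_product_append:
  assumes A: "A \<in> carrier_mat n n"
  shows "linear_factors_product A (es @ fs) = linear_factors_product A es * linear_factors_product A fs"
proof (induction es)
  case Nil
  then show ?case using A by (simp add: left_mult_one_mat[of _ n n])
next
  case (Cons e es)
  have "A - e \<cdot>\<^sub>m 1\<^sub>m n \<in> carrier_mat n n"
    by (intro minus_carrier_mat) simp
  then show ?case
    using Cons A by (simp add: linear_factors_product_Cons[OF A] assoc_mult_mat[of _ n n _ n _ n])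
qed

lemma linear_factors_product_similar:
  assumes c: "P \<in> carrier_mat n n" "Q \<in> carrier_mat n n" "A \<in> carrier_mat n n"
    and PQ: "P * Q = 1\<^sub>m n" "Q * P = 1\<^sub>m n"
  shows "linear_factors_product (Q * A * P) es = Q * linear_factors_product A es * P"
proof (induction es)
  case Nil
  then show ?case using assms by simp
next
  case (Cons e es)
  have QAP: "Q * A * P \<in> carrier_mat n n"
    using c by simp
  have "Q * (e \<cdot>\<^sub>m 1\<^sub>m n) * P = e \<cdot>\<^sub>m 1\<^sub>m n"
    using c by (simp add: mult_smult_distrib[of Q n n _ n] mult_smult_assoc_mat[of Q n n P n] PQ)
  then have "Q * (A - e \<cdot>\<^sub>m 1\<^sub>m n) * P = Q * A * P - e \<cdot>\<^sub>m 1\<^sub>m n"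
    using c mult_minus_distrib_mat[of Q n n A n "e \<cdot>\<^sub>m 1\<^sub>m n"]
      minus_mult_distrib_mat[of "Q * A" n n "Q * (e \<cdot>\<^sub>m 1\<^sub>m n)" P n] by simp
  moreover have "A - e \<cdot>\<^sub>m 1\<^sub>m n \<in> carrier_mat n n"
    by (intro minus_carrier_mat) simp
  ultimately show ?case
    unfolding linear_factors_product_Cons[OF QAP] linear_factors_product_Cons[OF c(3)] Cons
      similar_mult[OF c(1,2) \<open>A - e \<cdot>\<^sub>m 1\<^sub>m n \<in> carrier_mat n n\<close> linear_factors_product_carrier[OF c(3)] PQ(1)]
    by (simp only:)
qed

lemma linear_factors_product_block:
  assumes A: "A \<in> carrier_mat n n" and B: "B \<in> carrier_mat n m" and D: "D \<in> carrier_mat m m"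
  shows "\<exists>B'\<in>carrier_mat n m. linear_factors_product (four_block_mat A B (0\<^sub>m m n) D) es =
    four_block_mat (linear_factors_product A es) B' (0\<^sub>m m n) (linear_factors_product D es)"
proof (induction es)
  case Nil
  then show ?case using A D by (intro bexI[of _ "0\<^sub>m n m"]) auto
next
  case (Cons e es)
  let ?M = "four_block_mat A B (0\<^sub>m m n) D"
  have M: "?M \<in> carrier_mat (n + m) (n + m)"
    using A D by simp
  obtain B' where B': "B' \<in> carrier_mat n m" "linear_factors_product ?M es =
      four_block_mat (linear_factors_product A es) B' (0\<^sub>m m n) (linear_factors_product D es)"
    using Cons by blast
  have "?M - e \<cdot>\<^sub>m 1\<^sub>m (n + m) = four_block_mat (A - e \<cdot>\<^sub>m 1\<^sub>m n) B (0\<^sub>m m n) (D - e \<cdot>\<^sub>m 1\<^sub>m m)"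
    using A B D by (intro eq_matI) auto
  then have "linear_factors_product ?M (e # es) = four_block_mat (A - e \<cdot>\<^sub>m 1\<^sub>m n) B (0\<^sub>m m n) (D - e \<cdot>\<^sub>m 1\<^sub>m m) *
      four_block_mat (linear_factors_product A es) B' (0\<^sub>m m n) (linear_factors_product D es)"
    using B' by (simp add: linear_factors_product_Cons[OF M])
  also have "\<dots> = four_block_mat ((A - e \<cdot>\<^sub>m 1\<^sub>m n) * linear_factors_product A es)
      ((A - e \<cdot>\<^sub>m 1\<^sub>m n) * B' + B * linear_factors_product D es) (0\<^sub>m m n)
      ((D - e \<cdot>\<^sub>m 1\<^sub>m m) * linear_factors_product D es)"
    using A B D B' by (intro block_upper_mult) auto
  finally show ?case
    using A B D B' by (intro bexI[of _ "(A - e \<cdot>\<^sub>m 1\<^sub>m n) * B' + B * linear_factors_product D es"])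
      (auto simp: linear_factors_product_Cons)
qed

text \<open>The list stands for the eigenvalues with multiplicity, and the vanishing product for the
  Cayley-Hamilton theorem. Induction on \<open>n\<close>: if an eigenspace is everything, the matrix
  is scalar; otherwise it gives a block triangular form, and the lists of the two diagonal blocks
  are concatenated.\<close>

lemma eigenvalue_list_exists:
  fixes A :: "'a::alg_closed_field mat"
  assumes "A \<in> carrier_mat n n"
  shows "\<exists>es. length es = n \<and> linear_factors_product A es = 0\<^sub>m n n \<and>
    (\<forall>k. mat_trace (A ^\<^sub>m k) = (\<Sum>e\<leftarrow>es. e ^ k))"
  using assms
proof (induction n arbitrary: A rule: less_induct)
  case (less n)
  note A = less.prems
  show ?case
  proof (cases "n = 0")
    case True
    then show ?thesis using A by (intro exI[of _ "[]"]) (auto simp: mat_trace_def)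
  next
    case False
    interpret vec_space "TYPE('a)" n .
    have "Polynomial.degree (char_poly A) > 0"
      using degree_monic_char_poly[OF A] False by simp
    then obtain e where "poly (char_poly A) e = 0"
      using alg_closed_imp_poly_has_root by blast
    then obtain v where v: "v \<in> carrier_vec n" "v \<noteq> 0\<^sub>v n" "A *\<^sub>v v = e \<cdot>\<^sub>v v"
      using eigenvalue_root_char_poly[OF A] A unfolding eigenvalue_def eigenvector_def by auto
    define W where "W = {w \<in> carrier_vec n. A *\<^sub>v w = e \<cdot>\<^sub>v w}"
    have inv: "A *\<^sub>v w \<in> W" if "w \<in> W" for w
      using that A by (auto simp: W_def mult_mat_vec)
    have "LinearCombinations.submodule class_ring W V"
      unfolding submodule_def
    proof (intro conjI allI impI)
      show "Module.module class_ring V" by (rule module_axioms)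
      show "W \<subseteq> carrier V" by (auto simp: W_def)
      show "v \<oplus>\<^bsub>V\<^esub> w \<in> W" if "v \<in> W" "w \<in> W" for v w
        using that A by (auto simp: W_def mult_add_distrib_mat_vec[of A n n] smult_add_distrib_vec[of _ n])
      show "\<zero>\<^bsub>V\<^esub> \<in> W" using A by (auto simp: W_def)
      show "c \<odot>\<^bsub>V\<^esub> v \<in> W" if "v \<in> W" for c v
        using that A by (auto simp: W_def mult_mat_vec[of A n n] smult_smult_assoc mult.commute)
    qed
    then have Wsub: "VectorSpace.subspace class_ring W V"
      by (simp add: VectorSpace.subspace_def vectorspace_axioms)
    have W0: "W \<noteq> {0\<^sub>v n}"
      using v by (auto simp: W_def)
    show ?thesis
    proof (cases "W = carrier_vec n")
      case True
      have A_eq: "A = e \<cdot>\<^sub>m 1\<^sub>m n"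
      proof (rule eq_matI)
        fix i j assume "i < dim_row (e \<cdot>\<^sub>m 1\<^sub>m n :: 'a mat)" "j < dim_col (e \<cdot>\<^sub>m 1\<^sub>m n :: 'a mat)"
        then have ij: "i < n" "j < n" by auto
        have "unit_vec n j \<in> W"
          unfolding True by simp
        then have "A *\<^sub>v unit_vec n j = e \<cdot>\<^sub>v unit_vec n j"
          by (simp add: W_def)
        then have "(A *\<^sub>v unit_vec n j) $ i = (e \<cdot>\<^sub>v unit_vec n j) $ i"
          by (rule arg_cong)
        then show "A $$ (i, j) = (e \<cdot>\<^sub>m 1\<^sub>m n) $$ (i, j)"
          using A ij by (simp add: scalar_prod_right_unit[of _ n])
      qed (use A in auto)
      have pow: "A ^\<^sub>m k = (e ^ k) \<cdot>\<^sub>m 1\<^sub>m n" for k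
        by (induction k) (auto simp: A_eq mult_smult_distrib[of _ n n] mult_smult_assoc_mat[of _ n n] intro!: eq_matI)
      \<comment> \<open>A single factor already vanishes; the other \<open>m\<close> copies of
        \<open>e\<close> give the list its length and the right power sums.\<close>
      obtain m where m: "n = Suc m"
        using False not0_implies_Suc by blast
      have zero: "A - e \<cdot>\<^sub>m 1\<^sub>m n = 0\<^sub>m n n"
        using A by (auto simp: A_eq intro!: eq_matI)
      have "linear_factors_product A (e # replicate m e) = 0\<^sub>m n n"
        unfolding linear_factors_product_Cons[OF A] zero using A
        by (intro left_mult_zero_mat linear_factors_product_carrier)
      moreover have "mat_trace (A ^\<^sub>m k) = (\<Sum>e\<leftarrow>replicate n e. e ^ k)" for k
        by (simp add: pow mat_trace_def sum_list_replicate)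
      ultimately show ?thesis
        using m by (intro exI[of _ "replicate n e"]) simp
    next
      case False
      obtain P Q d where P: "P \<in> carrier_mat n n" and Q: "Q \<in> carrier_mat n n"
        and PQ: "P * Q = 1\<^sub>m n" "Q * P = 1\<^sub>m n" and d: "0 < d" "d < n"
        and "\<exists>B1\<in>carrier_mat d d. \<exists>B2\<in>carrier_mat d (n - d). \<exists>B4\<in>carrier_mat (n - d) (n - d).
          Q * A * P = four_block_mat B1 B2 (0\<^sub>m (n - d) d) B4"
        using block_triangularization[OF Wsub W0 False] A inv by meson
      then obtain B1 B2 B4 where B: "B1 \<in> carrier_mat d d" "B2 \<in> carrier_mat d (n - d)"
        "B4 \<in> carrier_mat (n - d) (n - d)" and C: "Q * A * P = four_block_mat B1 B2 (0\<^sub>m (n - d) d) B4"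
        by blast
      obtain es where es: "length es = d" "linear_factors_product B1 es = 0\<^sub>m d d"
        "\<And>k. mat_trace (B1 ^\<^sub>m k) = (\<Sum>e\<leftarrow>es. e ^ k)"
        using less.IH[OF d(2) B(1)] by blast
      obtain fs where fs: "length fs = n - d" "linear_factors_product B4 fs = 0\<^sub>m (n - d) (n - d)"
        "\<And>k. mat_trace (B4 ^\<^sub>m k) = (\<Sum>e\<leftarrow>fs. e ^ k)"
        using less.IH[OF _ B(3)] d by auto
      obtain Z where Z: "Z \<in> carrier_mat d (n - d)" "linear_factors_product (Q * A * P) es =
          four_block_mat (0\<^sub>m d d) Z (0\<^sub>m (n - d) d) (linear_factors_product B4 es)"
        using linear_factors_product_block[OF B, of es] es(2) C by auto
      obtain Y where Y: "Y \<in> carrier_mat d (n - d)" "linear_factors_product (Q * A * P) fs =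
          four_block_mat (linear_factors_product B1 fs) Y (0\<^sub>m (n - d) d) (0\<^sub>m (n - d) (n - d))"
        using linear_factors_product_block[OF B, of fs] fs(2) C by auto
      have QAP: "Q * A * P \<in> carrier_mat n n"
        using A P Q by simp
      \<comment> \<open>The product over \<open>es\<close> has zero first block column and the
        product over \<open>fs\<close> zero second block row, so in this order they multiply to
        zero.\<close>
      have "linear_factors_product (Q * A * P) (es @ fs) = 0\<^sub>m n n"
      proof -
        have "linear_factors_product (Q * A * P) (es @ fs) =
          four_block_mat (0\<^sub>m d d) (0\<^sub>m d (n - d)) (0\<^sub>m (n - d) d) (0\<^sub>m (n - d) (n - d))"
          unfolding linear_factors_product_append[OF QAP] Z Y
          using B Z(1) Y(1)
          by (subst block_upper_mult)
            (auto simp: left_mult_zero_mat[OF linear_factors_product_carrier[OF B(1)]]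
              right_mult_zero_mat[OF linear_factors_product_carrier[OF B(3)]])
        then show ?thesis using d by simp
      qed
      then have "Q * linear_factors_product A (es @ fs) * P = 0\<^sub>m n n"
        by (simp add: linear_factors_product_similar[OF P Q A PQ])
      then have "P * (Q * linear_factors_product A (es @ fs) * P) * Q = 0\<^sub>m n n"
        using P Q by simp
      moreover have "P * (Q * M * P) * Q = M" if M: "M \<in> carrier_mat n n" for M
      proof -
        have "P * (Q * M * P) * Q = (P * Q) * M * (P * Q)"
          using P Q M by (simp add: assoc_mult_mat[of _ n n _ n _ n])
        then show ?thesis using M by (simp add: PQ)
      qed
      ultimately have "linear_factors_product A (es @ fs) = 0\<^sub>m n n"
        using A by simp
      moreover have "mat_trace (A ^\<^sub>m k) = (\<Sum>e\<leftarrow>es @ fs. e ^ k)" for k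
      proof -
        have "mat_trace (A ^\<^sub>m k) = mat_trace ((Q * A * P) ^\<^sub>m k)"
          using mat_trace_similar[OF P Q _ PQ(1), of "A ^\<^sub>m k"] similar_pow[OF P Q A PQ, of k] A by simp
        also have "\<dots> = mat_trace (B1 ^\<^sub>m k) + mat_trace (B4 ^\<^sub>m k)"
          using block_upper_pow[OF B, of k] B by (auto simp: C mat_trace_four_block[of _ d _ "n - d"])
        finally show ?thesis
          by (simp add: es fs)
      qed
      ultimately show ?thesis
        using es fs d by (intro exI[of _ "es @ fs"]) simp
    qed
  qed
qed

text \<open>Along a composition series all operators are block triangular with irreducible diagonal
  blocks, on which \<open>z\<close> acts by zero, so the product has zero diagonal blocks. The
  induction splits along one invariant subspace at a time; both diagonal blocks are again
  representations.\<close>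

lemma trace_nilpotent_radical:
  fixes scale :: "'k::field \<Rightarrow> 'a::ab_group_add \<Rightarrow> 'a"
  assumes "representation scale bracket n \<sigma>" and "z \<in> nilpotent_radical scale bracket"
  shows "mat_trace (\<sigma> x ^\<^sub>m k * \<sigma> z) = 0"
  using assms(1)
proof (induction n arbitrary: \<sigma> rule: less_induct)
  case (less n)
  note rep = less.prems
  have \<sigma>: "\<sigma> x \<in> carrier_mat n n" for x
    using rep by (simp add: representation_def)
  show ?case
  proof (cases "n = 0 \<or> irreducible_representation scale bracket n \<sigma>")
    case True
    then show ?thesis
    proof
      assume "n = 0"
      then show ?thesis using \<sigma>[of z] \<sigma>[of x] by (simp add: mat_trace_def)
    next
      assume "irreducible_representation scale bracket n \<sigma>"
      then have "\<sigma> z = 0\<^sub>m n n"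
        using assms(2) by (simp add: nilpotent_radical_def)
      then show ?thesis using \<sigma>[of x] by (simp add: right_mult_zero_mat[of _ n n])
    qed
  next
    case False
    then have "n > 0" by simp
    with False obtain W where W: "VectorSpace.subspace class_ring W (module_vec TYPE('k) n)"
      "\<And>x v. v \<in> W \<Longrightarrow> \<sigma> x *\<^sub>v v \<in> W" "W \<noteq> {0\<^sub>v n}" "W \<noteq> carrier_vec n"
      using rep unfolding irreducible_representation_def by blast
    interpret vec_space "TYPE('k)" n .
    obtain P Q d where P: "P \<in> carrier_mat n n" and Q: "Q \<in> carrier_mat n n"
      and PQ: "P * Q = 1\<^sub>m n" "Q * P = 1\<^sub>m n" and d: "0 < d" "d < n"
      and "\<forall>A\<in>carrier_mat n n. (\<forall>v\<in>W. A *\<^sub>v v \<in> W) \<longrightarrow>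
        (\<exists>B1\<in>carrier_mat d d. \<exists>B2\<in>carrier_mat d (n - d). \<exists>B4\<in>carrier_mat (n - d) (n - d).
        Q * A * P = four_block_mat B1 B2 (0\<^sub>m (n - d) d) B4)"
      using block_triangularization[OF W(1,3,4)] by blast
    then have "\<exists>B1 B2 B4. B1 \<in> carrier_mat d d \<and> B2 \<in> carrier_mat d (n - d) \<and> B4 \<in> carrier_mat (n - d) (n - d) \<and>
        Q * \<sigma> x * P = four_block_mat B1 B2 (0\<^sub>m (n - d) d) B4" for x
      using \<sigma> W(2) by blast
    then obtain \<sigma>1 \<tau> \<sigma>2 where B: "\<And>x. \<sigma>1 x \<in> carrier_mat d d" "\<And>x. \<tau> x \<in> carrier_mat d (n - d)"
      "\<And>x. \<sigma>2 x \<in> carrier_mat (n - d) (n - d)"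
      and C: "\<And>x. Q * \<sigma> x * P = four_block_mat (\<sigma>1 x) (\<tau> x) (0\<^sub>m (n - d) d) (\<sigma>2 x)"
      by metis
    let ?F = "\<lambda>A B D. four_block_mat A B (0\<^sub>m (n - d) d) D"
    \<comment> \<open>Diagonal blocks are determined by the block matrix, so the laws of
      \<open>\<sigma>\<close> pass to \<open>\<sigma>1\<close> and \<open>\<sigma>2\<close> by
      comparing blocks.\<close>
    have inj: "A = A' \<and> D = D'"
      if "?F A B D = ?F A' B' D'" "A \<in> carrier_mat d d" "A' \<in> carrier_mat d d"
        "B \<in> carrier_mat d (n - d)" "B' \<in> carrier_mat d (n - d)"
        "D \<in> carrier_mat (n - d) (n - d)" "D' \<in> carrier_mat (n - d) (n - d)"
      for A B D A' B' D' :: "'k mat"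
    proof
      show "A = A'"
      proof (rule eq_matI)
        fix i j assume "i < dim_row A'" "j < dim_col A'"
        then show "A $$ (i, j) = A' $$ (i, j)"
          using arg_cong[OF that(1), of "\<lambda>M. M $$ (i, j)"] that(2-) by simp
      qed (use that in auto)
      show "D = D'"
      proof (rule eq_matI)
        fix i j assume "i < dim_row D'" "j < dim_col D'"
        then show "D $$ (i, j) = D' $$ (i, j)"
          using arg_cong[OF that(1), of "\<lambda>M. M $$ (i + d, j + d)"] that(2-) by simp
      qed (use that in auto)
    qed
    have add: "\<sigma>1 (x + y) = \<sigma>1 x + \<sigma>1 y \<and> \<sigma>2 (x + y) = \<sigma>2 x + \<sigma>2 y" for x y
    proof (rule inj)
      have "Q * \<sigma> (x + y) * P = Q * \<sigma> x * P + Q * \<sigma> y * P"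
        using rep P Q \<sigma>
        by (simp add: representation_def mult_add_distrib_mat[of Q n n _ n] add_mult_distrib_mat[of _ n n _ P n])
      then show "?F (\<sigma>1 (x + y)) (\<tau> (x + y)) (\<sigma>2 (x + y)) = ?F (\<sigma>1 x + \<sigma>1 y) (\<tau> x + \<tau> y) (\<sigma>2 x + \<sigma>2 y)"
        using B by (simp add: C add_four_block_mat[of _ d d _ "n - d" _ "n - d"])
    qed (use B in auto)
    have scale: "\<sigma>1 (scale c x) = c \<cdot>\<^sub>m \<sigma>1 x \<and> \<sigma>2 (scale c x) = c \<cdot>\<^sub>m \<sigma>2 x" for c x
    proof (rule inj)
      have "Q * \<sigma> (scale c x) * P = c \<cdot>\<^sub>m (Q * \<sigma> x * P)"
        using rep P Q \<sigma>
        by (simp add: representation_def mult_smult_distrib[of Q n n _ n] mult_smult_assoc_mat[of _ n n P n])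
      then show "?F (\<sigma>1 (scale c x)) (\<tau> (scale c x)) (\<sigma>2 (scale c x)) = ?F (c \<cdot>\<^sub>m \<sigma>1 x) (c \<cdot>\<^sub>m \<tau> x) (c \<cdot>\<^sub>m \<sigma>2 x)"
        using B by (simp add: C smult_four_block_mat[of _ d d _ "n - d" _ "n - d"])
    qed (use B in auto)
    have mult: "Q * (\<sigma> x * \<sigma> y) * P = ?F (\<sigma>1 x * \<sigma>1 y) (\<sigma>1 x * \<tau> y + \<tau> x * \<sigma>2 y) (\<sigma>2 x * \<sigma>2 y)" for x y
      using P Q \<sigma> B by (simp add: similar_mult[OF P Q _ _ PQ(1)] C block_upper_mult)
    have br: "\<sigma>1 (bracket x y) = \<sigma>1 x * \<sigma>1 y - \<sigma>1 y * \<sigma>1 x \<and> \<sigma>2 (bracket x y) = \<sigma>2 x * \<sigma>2 y - \<sigma>2 y * \<sigma>2 x" for x y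
    proof (rule inj)
      have "Q * \<sigma> (bracket x y) * P = Q * (\<sigma> x * \<sigma> y) * P - Q * (\<sigma> y * \<sigma> x) * P"
        using rep P Q \<sigma> mult_carrier_mat[OF \<sigma> \<sigma>] mult_carrier_mat[OF Q mult_carrier_mat[OF \<sigma> \<sigma>]]
          mult_minus_distrib_mat[of Q n n "\<sigma> x * \<sigma> y" n "\<sigma> y * \<sigma> x"]
          minus_mult_distrib_mat[of "Q * (\<sigma> x * \<sigma> y)" n n "Q * (\<sigma> y * \<sigma> x)" P n]
        by (simp add: representation_def)
      moreover have diff: "?F A B D - ?F A' B' D' = ?F (A - A') (B - B') (D - D')"
        if "A \<in> carrier_mat d d" "A' \<in> carrier_mat d d"
          "B \<in> carrier_mat d (n - d)" "B' \<in> carrier_mat d (n - d)"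
          "D \<in> carrier_mat (n - d) (n - d)" "D' \<in> carrier_mat (n - d) (n - d)"
        for A B D A' B' D' :: "'k mat"
        using that by (intro eq_matI) auto
      ultimately show "?F (\<sigma>1 (bracket x y)) (\<tau> (bracket x y)) (\<sigma>2 (bracket x y)) =
        ?F (\<sigma>1 x * \<sigma>1 y - \<sigma>1 y * \<sigma>1 x) ((\<sigma>1 x * \<tau> y + \<tau> x * \<sigma>2 y) - (\<sigma>1 y * \<tau> x + \<tau> y * \<sigma>2 x))
          (\<sigma>2 x * \<sigma>2 y - \<sigma>2 y * \<sigma>2 x)"
        unfolding C mult
        by (subst diff[symmetric])
          (simp_all add: mult_carrier_mat[OF B(1) B(1)] mult_carrier_mat[OF B(1) B(2)]
            mult_carrier_mat[OF B(2) B(3)] mult_carrier_mat[OF B(3) B(3)])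
    qed (use B in \<open>auto intro!: minus_carrier_mat add_carrier_mat mult_carrier_mat[OF B(1) B(1)]
        mult_carrier_mat[OF B(1) B(2)] mult_carrier_mat[OF B(2) B(3)] mult_carrier_mat[OF B(3) B(3)]\<close>)
    have rep1: "representation scale bracket d \<sigma>1" and rep2: "representation scale bracket (n - d) \<sigma>2"
      using B add scale br by (simp_all add: representation_def)
    obtain Y where Y: "Y \<in> carrier_mat d (n - d)" "Q * \<sigma> x ^\<^sub>m k * P = ?F (\<sigma>1 x ^\<^sub>m k) Y (\<sigma>2 x ^\<^sub>m k)"
      using block_upper_pow[OF B, of x x x k] similar_pow[OF P Q \<sigma> PQ, of x k] C by auto
    have "mat_trace (\<sigma> x ^\<^sub>m k * \<sigma> z) = mat_trace (Q * (\<sigma> x ^\<^sub>m k * \<sigma> z) * P)"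
      by (rule mat_trace_similar[OF P Q mult_carrier_mat[OF pow_carrier_mat[OF \<sigma>] \<sigma>] PQ(1), symmetric])
    also have "Q * (\<sigma> x ^\<^sub>m k * \<sigma> z) * P = ?F (\<sigma>1 x ^\<^sub>m k * \<sigma>1 z) (\<sigma>1 x ^\<^sub>m k * \<tau> z + Y * \<sigma>2 z) (\<sigma>2 x ^\<^sub>m k * \<sigma>2 z)"
      using \<sigma> B Y by (simp add: similar_mult[OF P Q _ _ PQ(1)] pow_carrier_mat C block_upper_mult)
    also have "mat_trace \<dots> = mat_trace (\<sigma>1 x ^\<^sub>m k * \<sigma>1 z) + mat_trace (\<sigma>2 x ^\<^sub>m k * \<sigma>2 z)"
      by (intro mat_trace_four_block[of _ d _ "n - d"] mult_carrier_mat[OF pow_carrier_mat[OF B(1)] B(1)]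
          mult_carrier_mat[OF pow_carrier_mat[OF B(3)] B(3)])
    also have "\<dots> = 0"
      using less.IH[OF d(2) rep1] less.IH[OF _ rep2] d by simp
    finally show ?thesis .
  qed
qed

subsection \<open>Operators on matrices\<close>

text \<open>
  Matrices with entries outside the leading \<open>n \<times> n\<close> block are admitted, so that they form a vector
  space on a whole type; \<^const>\<open>Matrix.carrier_mat\<close> is only a subset of a type without zero.
\<close>

definition fscale :: "'c::times \<Rightarrow> (nat \<Rightarrow> nat \<Rightarrow> 'c) \<Rightarrow> nat \<Rightarrow> nat \<Rightarrow> 'c"
  where "fscale c A = (\<lambda>i j. c * A i j)"

definition fmul :: "nat \<Rightarrow> (nat \<Rightarrow> nat \<Rightarrow> 'c::comm_ring) \<Rightarrow> (nat \<Rightarrow> nat \<Rightarrow> 'c) \<Rightarrow> nat \<Rightarrow> nat \<Rightarrow> 'c"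
  where "fmul n A B = (\<lambda>i j. \<Sum>k<n. A i k * B k j)"

definition ftrace :: "nat \<Rightarrow> (nat \<Rightarrow> nat \<Rightarrow> 'c::comm_monoid_add) \<Rightarrow> 'c"
  where "ftrace n A = (\<Sum>i<n. A i i)"

definition fmat :: "nat \<Rightarrow> 'c::zero mat \<Rightarrow> nat \<Rightarrow> nat \<Rightarrow> 'c"
  where "fmat n A = (\<lambda>i j. if i < n \<and> j < n then A $$ (i, j) else 0)"

interpretation fmat: polynomial_operators "fscale :: 'c::field \<Rightarrow> _"
  by unfold_locales (auto simp: fscale_def fun_eq_iff plus_fun_def algebra_simps)

lemma fmul_assoc: "fmul n (fmul n A B) C = fmul n A (fmul n B C)"
proof (intro ext)
  fix i j
  have "fmul n (fmul n A B) C i j = (\<Sum>k<n. \<Sum>l<n. A i l * B l k * C k j)"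
    by (simp add: fmul_def sum_distrib_right)
  also have "\<dots> = (\<Sum>l<n. \<Sum>k<n. A i l * B l k * C k j)"
    by (rule sum.swap)
  also have "\<dots> = fmul n A (fmul n B C) i j"
    by (simp add: fmul_def sum_distrib_left mult.assoc)
  finally show "fmul n (fmul n A B) C i j = fmul n A (fmul n B C) i j" .
qed

lemma endo_fmul_left: "fmat.endo (fmul n A)" for A :: "nat \<Rightarrow> nat \<Rightarrow> 'c::field"
  by (auto simp: fmat.endo_def fmul_def fscale_def fun_eq_iff plus_fun_def sum.distrib sum_distrib_left algebra_simps)

lemma endo_fmul_right: "fmat.endo (\<lambda>B. fmul n B A)" for A :: "nat \<Rightarrow> nat \<Rightarrow> 'c::field"
  by (auto simp: fmat.endo_def fmul_def fscale_def fun_eq_iff plus_fun_def sum.distrib sum_distrib_left algebra_simps)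

lemma ftrace_add: "ftrace n (A + B) = ftrace n A + ftrace n B"
  by (simp add: ftrace_def plus_fun_def sum.distrib)

lemma ftrace_diff: "ftrace n (A - B) = ftrace n A - ftrace n B" for A :: "nat \<Rightarrow> nat \<Rightarrow> 'c::ab_group_add"
  by (simp add: ftrace_def fun_diff_def sum_subtractf)

lemma ftrace_scale: "ftrace n (fscale c A) = c * ftrace n A" for c :: "'c::comm_ring"
  by (simp add: ftrace_def fscale_def sum_distrib_left)

lemma ftrace_zero: "ftrace n 0 = 0"
  by (simp add: ftrace_def zero_fun_def)

lemma ftrace_sum: "ftrace n (sum f I) = (\<Sum>i\<in>I. ftrace n (f i))"
  by (induction I rule: infinite_finite_induct)
    (simp_all only: sum.infinite sum.empty sum.insert ftrace_zero ftrace_add not_False_eq_True)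

lemma ftrace_fmul_comm: "ftrace n (fmul n A B) = ftrace n (fmul n B A)"
  unfolding ftrace_def fmul_def by (subst sum.swap) (simp add: mult.commute)

lemma fmat_mult:
  assumes "A \<in> carrier_mat n n" "B \<in> carrier_mat n n"
  shows "fmat n (A * B) = fmul n (fmat n A) (fmat n B)"
proof (intro ext)
  fix i j
  show "fmat n (A * B) i j = fmul n (fmat n A) (fmat n B) i j"
    using assms by (cases "i < n"; cases "j < n") (auto simp: fmat_def fmul_def scalar_prod_def atLeast0LessThan)
qed

lemma fmat_add: "A \<in> carrier_mat n n \<Longrightarrow> B \<in> carrier_mat n n \<Longrightarrow> fmat n (A + B) = fmat n A + fmat n B"
  for A :: "'c::monoid_add mat"
  by (auto simp: fmat_def fun_eq_iff plus_fun_def)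

lemma fmat_diff: "A \<in> carrier_mat n n \<Longrightarrow> B \<in> carrier_mat n n \<Longrightarrow> fmat n (A - B) = fmat n A - fmat n B"
  for A :: "'c::ab_group_add mat"
  by (auto simp: fmat_def fun_eq_iff fun_diff_def)

lemma fmat_smult: "A \<in> carrier_mat n n \<Longrightarrow> fmat n (c \<cdot>\<^sub>m A) = fscale c (fmat n A)" for c :: "'c::comm_ring"
  by (auto simp: fmat_def fun_eq_iff fscale_def)

lemma fmat_zero: "fmat n (0\<^sub>m n n) = 0"
  by (auto simp: fmat_def fun_eq_iff zero_fun_def)

lemma fmat_eq_zero: 
  assumes A: "A \<in> carrier_mat n n" and "fmat n A = 0"
  shows "A = 0\<^sub>m n n"
proof (rule eq_matI)
  fix i j assume "i < dim_row (0\<^sub>m n n :: 'a mat)" "j < dim_col (0\<^sub>m n n :: 'a mat)"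
  then show "A $$ (i, j) = 0\<^sub>m n n $$ (i, j)"
    using fun_cong[OF fun_cong[OF assms(2)], of i j] by (simp add: fmat_def)
qed (use A in auto)

lemma ftrace_fmat: "A \<in> carrier_mat n n \<Longrightarrow> ftrace n (fmat n A) = mat_trace A"
  by (simp add: ftrace_def fmat_def mat_trace_def)

lemma fmul_funpow_fmat:
  assumes A: "A \<in> carrier_mat n n" and "B \<in> carrier_mat n n"
  shows "(fmul n (fmat n A) ^^ k) (fmat n B) = fmat n (A ^\<^sub>m k * B)"
  using assms(2)
proof (induction k arbitrary: B)
  case 0
  then show ?case using A by simp
next
  case (Suc k)
  then show ?case
    using A fmat_mult[OF A Suc.prems] Suc.IH[of "A * B"] assoc_mult_mat[OF pow_carrier_mat[OF A] A Suc.prems, of k]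
    by (simp add: funpow_Suc_right del: funpow.simps)
qed

text \<open>Turns the vanishing of \<open>linear_factors_product A es\<close> into a polynomial that
  annihilates left multiplication by \<open>A\<close> on \<open>n\<close> by \<open>n\<close>
  matrices.\<close>

lemma poly_op_fmul_left_linear_factors:
  fixes A :: "'c::field mat"
  assumes A: "A \<in> carrier_mat n n" and B: "B \<in> carrier_mat n n"
  shows "fmat.poly_op (fmul n (fmat n A)) (\<Prod>e\<leftarrow>es. [:- e, 1:]) (fmat n B) =
    fmat n (linear_factors_product A es * B)"
proof (induction es)
  case Nil
  then show ?case using A B by simp
next
  case (Cons e es)
  let ?M = "linear_factors_product A es * B"
  have M: "?M \<in> carrier_mat n n"
    by (rule mult_carrier_mat[OF linear_factors_product_carrier[OF A] B])
  have Ae: "A - e \<cdot>\<^sub>m 1\<^sub>m n \<in> carrier_mat n n"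
    by (intro minus_carrier_mat) simp
  have "fmat.poly_op (fmul n (fmat n A)) (\<Prod>e\<leftarrow>e # es. [:- e, 1:]) (fmat n B) =
      fmul n (fmat n A) (fmat n ?M) - fscale e (fmat n ?M)"
    by (simp only: list.map prod_list.Cons fmat.poly_op_mult[OF endo_fmul_left]
        fmat.poly_op_linear[OF endo_fmul_left] Cons.IH)
  also have "\<dots> = fmat n (A * ?M - e \<cdot>\<^sub>m ?M)"
    using A M by (simp add: fmat_diff fmat_mult[OF A M] fmat_smult)
  also have "A * ?M - e \<cdot>\<^sub>m ?M = (A - e \<cdot>\<^sub>m 1\<^sub>m n) * ?M"
    using A M by (simp add: minus_mult_distrib_mat[OF A _ M] mult_smult_assoc_mat[OF one_carrier_mat M]
        left_mult_one_mat[OF M])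
  also have "\<dots> = linear_factors_product A (e # es) * B"
    unfolding linear_factors_product_Cons[OF A]
    by (rule assoc_mult_mat[OF Ae linear_factors_product_carrier[OF A] B, symmetric])
  finally show ?case .
qed

lemma poly_op_fmul_right_linear_factors:
  fixes A :: "'c::field mat"
  assumes A: "A \<in> carrier_mat n n" and "B \<in> carrier_mat n n"
  shows "fmat.poly_op (\<lambda>B. fmul n B (fmat n A)) (\<Prod>e\<leftarrow>es. [:- e, 1:]) (fmat n B) =
    fmat n (B * linear_factors_product A es)"
  using assms(2)
proof (induction es arbitrary: B)
  case Nil
  then show ?case using A by simp
next
  case (Cons e es)
  note B = Cons.prems
  have Ae: "A - e \<cdot>\<^sub>m 1\<^sub>m n \<in> carrier_mat n n"
    by (intro minus_carrier_mat) simp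
  have BA: "B * A - e \<cdot>\<^sub>m B = B * (A - e \<cdot>\<^sub>m 1\<^sub>m n)"
    using A B by (simp add: mult_minus_distrib_mat[OF B A] mult_smult_distrib[OF B one_carrier_mat])
  have "fmul n (fmat n B) (fmat n A) - fscale e (fmat n B) = fmat n (B * (A - e \<cdot>\<^sub>m 1\<^sub>m n))"
    using A B by (simp add: fmat_diff fmat_mult fmat_smult flip: BA)
  \<comment> \<open>The first factor of the list has to stand next to \<open>B\<close>, hence must
    be applied first; the polynomial factors commute and are swapped for this.\<close>
  then have "fmat.poly_op (\<lambda>B. fmul n B (fmat n A)) (\<Prod>e\<leftarrow>e # es. [:- e, 1:]) (fmat n B) =
      fmat n (B * (A - e \<cdot>\<^sub>m 1\<^sub>m n) * linear_factors_product A es)"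
    using Cons.IH[OF mult_carrier_mat[OF B Ae]]
    by (simp only: list.map prod_list.Cons mult.commute[of "[:- e, 1:]"] fmat.poly_op_mult[OF endo_fmul_right]
        fmat.poly_op_linear[OF endo_fmul_right])
  then show ?case
    by (simp only: linear_factors_product_Cons[OF A] assoc_mult_mat[OF B Ae linear_factors_product_carrier[OF A]])
qed

lemma poly_op_fmul_commute:
  fixes A B C :: "nat \<Rightarrow> nat \<Rightarrow> 'c::field"
  shows "fmat.poly_op (fmul n A) q (fmul n B C) = fmul n (fmat.poly_op (fmul n A) q B) C"
  by (rule fmat.poly_op_commute[where S = "\<lambda>B. fmul n B C", OF endo_fmul_right]) (simp add: fmul_assoc)

lemma ftrace_poly_op:
  fixes A B :: "nat \<Rightarrow> nat \<Rightarrow> 'c::field"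
  assumes "fmat.endo T"
  shows "ftrace n (fmat.poly_op T q B) = (\<Sum>i\<le>Polynomial.degree q. Polynomial.coeff q i * ftrace n ((T ^^ i) B))"
  by (simp add: fmat.poly_op_def ftrace_sum ftrace_scale)

text \<open>By cyclicity of the trace, left multiplication by \<open>A\<close> on one factor becomes
  right multiplication by \<open>A\<close> on the other, for each power and hence for
  \<open>q\<close>.\<close>

lemma ftrace_fmul_swap:
  fixes A B C :: "nat \<Rightarrow> nat \<Rightarrow> 'c::field"
  shows "ftrace n (fmul n (fmat.poly_op (fmul n A) q B) C) =
    ftrace n (fmul n (fmat.poly_op (\<lambda>B. fmul n B A) q C) B)"
proof -
  have pow: "ftrace n (fmul n ((fmul n A ^^ i) B) C) = ftrace n (fmul n (((\<lambda>B. fmul n B A) ^^ i) C) B)" for i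
  proof (induction i arbitrary: C)
    case 0
    then show ?case by (simp add: ftrace_fmul_comm)
  next
    case (Suc i)
    have "ftrace n (fmul n ((fmul n A ^^ Suc i) B) C) = ftrace n (fmul n ((fmul n A ^^ i) B) (fmul n C A))"
      using ftrace_fmul_comm[of n A "fmul n ((fmul n A ^^ i) B) C"] by (simp add: fmul_assoc)
    then show ?case
      using Suc[of "fmul n C A"] by (simp add: funpow_Suc_right del: funpow.simps)
  qed
  have expand: "ftrace n (fmul n (fmat.poly_op T q V) W) =
      (\<Sum>i\<le>Polynomial.degree q. Polynomial.coeff q i * ftrace n (fmul n ((T ^^ i) V) W))"
    for T and V W :: "nat \<Rightarrow> nat \<Rightarrow> 'c"
    unfolding fmat.poly_op_def fmat.endo_sum[OF endo_fmul_right] fmat.endo_scale[OF endo_fmul_right]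
      ftrace_sum ftrace_scale ..
  show ?thesis
    by (simp add: expand pow)
qed

text \<open>Extends the vector to a basis, possibly infinite: the lemma serves the algebraic closure
  as a space over the rationals and over the base field.\<close>

lemma separating_functional:
  assumes "vector_space scale" "v \<noteq> 0"
  shows "\<exists>f. (\<forall>x y. f (x + y) = f x + f y) \<and> (\<forall>c x. f (scale c x) = c * f x) \<and> f v = 1"
proof -
  interpret v: vector_space scale by fact
  interpret f: vector_space "(*) :: 'a \<Rightarrow> 'a \<Rightarrow> 'a"
    by unfold_locales (auto simp: algebra_simps)
  interpret p: vector_space_pair scale "(*) :: 'a \<Rightarrow> 'a \<Rightarrow> 'a" ..
  have "v.independent {v}"
    using assms(2) by simp
  then obtain g where g: "Vector_Spaces.linear scale (*) g" "g v = 1"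
    using p.linear_independent_extend[of "{v}" "\<lambda>_. 1"] by auto
  interpret g: Vector_Spaces.linear scale "(*)" g by fact
  show ?thesis
    using g(2) g.add g.scale by (intro exI[of _ g]) blast
qed

subsection \<open>Replicas and the eigenvalue argument\<close>

lemma prod_linear_dvd_power:
  fixes es :: "'c::field list"
  assumes "set es \<subseteq> S" "finite S" "length es \<le> N"
  shows "(\<Prod>e\<leftarrow>es. [:- e, 1:]) dvd (\<Prod>e\<in>S. [:- e, 1:] ^ N)"
proof -
  have "(\<Prod>e\<leftarrow>es. [:- e, 1:]) dvd (\<Prod>e\<in>S. [:- e, 1:]) ^ length es"
    using assms(1)
  proof (induction es)
    case (Cons e es)
    then show ?case
      using mult_dvd_mono[OF dvd_prodI[OF assms(2), of e "\<lambda>e. [:- e, 1:]"]]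
      by (simp only: list.map prod_list.Cons list.size add_Suc_right add_0_right power_Suc list.set insert_subset)
  qed simp
  also have "\<dots> dvd (\<Prod>e\<in>S. [:- e, 1:]) ^ N"
    by (rule le_imp_power_dvd) fact
  finally show ?thesis
    by (simp add: prod_power_distrib)
qed

text \<open>If the power sums of \<open>ls\<close> are the traces of the powers of a matrix A, the
  left-hand side is the trace of q(A) A; the \<open>Suc\<close> accounts for the last
  factor.\<close>

lemma sum_list_poly_eq:
  fixes q :: "'c::field poly"
  shows "(\<Sum>i\<le>Polynomial.degree q. Polynomial.coeff q i * (\<Sum>l\<leftarrow>ls. l ^ Suc i)) = (\<Sum>l\<leftarrow>ls. l * poly q l)"
proof (induction ls)
  case (Cons l ls)
  have "(\<Sum>i\<le>Polynomial.degree q. Polynomial.coeff q i * l ^ Suc i) = l * poly q l"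
    by (simp add: poly_altdef sum_distrib_left mult.left_commute)
  then show ?case
    using Cons by (simp add: distrib_left sum.distrib del: power_Suc)
qed simp

lemma to_ac_comm_ring_hom: "comm_ring_hom to_ac"
  by unfold_locales simp_all

lemma representation_ad_funpow:
  fixes scale :: "'k::field \<Rightarrow> 'a::ab_group_add \<Rightarrow> 'a"
  assumes "representation scale bracket n \<rho>"
  shows "((\<lambda>B. fmul n (fmat n (map_mat to_ac (\<rho> x))) B - fmul n B (fmat n (map_mat to_ac (\<rho> x)))) ^^ j)
      (fmat n (map_mat to_ac (\<rho> a))) = fmat n (map_mat to_ac (\<rho> ((bracket x ^^ j) a)))"
proof (induction j)
  case (Suc j)
  interpret ac: comm_ring_hom to_ac by (rule to_ac_comm_ring_hom)
  have c: "\<rho> a \<in> carrier_mat n n" for a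
    using assms by (simp add: representation_def)
  let ?a = "(bracket x ^^ j) a"
  have "fmat n (map_mat to_ac (\<rho> (bracket x ?a))) =
      fmat n (map_mat to_ac (\<rho> x) * map_mat to_ac (\<rho> ?a) - map_mat to_ac (\<rho> ?a) * map_mat to_ac (\<rho> x))"
  proof -
    have "map_mat to_ac (A - B) = map_mat to_ac A - map_mat to_ac B"
      if "A \<in> carrier_mat n n" "B \<in> carrier_mat n n" for A B :: "'k mat"
      using that by (intro eq_matI) auto
    then show ?thesis
      using assms mult_carrier_mat[OF c c]
      by (simp add: representation_def ac.mat_hom_mult[OF c c])
  qed
  also have "\<dots> = fmul n (fmat n (map_mat to_ac (\<rho> x))) (fmat n (map_mat to_ac (\<rho> ?a))) -
      fmul n (fmat n (map_mat to_ac (\<rho> ?a))) (fmat n (map_mat to_ac (\<rho> x)))"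
    using c by (simp add: fmat_diff[of _ n] mult_carrier_mat[of _ n n] fmat_mult)
  finally show ?case
    using Suc by simp
qed simp

text \<open>
  Packages the eigenvalue argument: the functionals \<open>\<phi>\<close> that have to be considered are
  \<open>z \<mapsto> \<psi>(tr(q(\<rho> x) \<rho> z))\<close> with \<open>\<psi> : K \<rightarrow> k\<close> linear, and the two closure conditions on \<open>\<phi>\<close> are all
  that is needed to represent \<open>\<phi>\<close> by an element of \<open>\<uu>\<close>. The coefficients \<open>c\<close> are \<open>\<psi>\<close> of those of \<open>p\<close>.
\<close>

lemma trace_functional_criterion:
  fixes scale :: "'k::field_char_0 \<Rightarrow> 'a::ab_group_add \<Rightarrow> 'a"
  assumes rep: "representation scale bracket n \<rho>"
    and M: "M \<ge> 1"
    and crit: "\<And>\<phi>. (\<And>z w. \<phi> (z + w) = \<phi> z + \<phi> w) \<Longrightarrow> (\<And>c z. \<phi> (scale c z) = c * \<phi> z) \<Longrightarrow>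
      (\<And>z. (\<And>k. mat_trace (\<rho> x ^\<^sub>m k * \<rho> z) = 0) \<Longrightarrow> \<phi> z = 0) \<Longrightarrow>
      (\<And>a. \<exists>c N. \<forall>z. \<phi> (bracket a z) = (\<Sum>j\<in>{M..N}. c j * mat_trace (\<rho> ((bracket x ^^ j) a) * \<rho> z))) \<Longrightarrow>
      \<phi> x = 0"
  shows "nilpotent_mat (\<rho> x)" and "j \<ge> n + n \<Longrightarrow> \<rho> ((bracket x ^^ j) a) = 0\<^sub>m n n"
proof -
  interpret ac: comm_ring_hom "to_ac :: 'k \<Rightarrow> _" by (rule to_ac_comm_ring_hom)
  have c: "\<rho> a \<in> carrier_mat n n" for a
    using rep by (simp add: representation_def)
  define R where "R a = map_mat to_ac (\<rho> a)" for a
  have R: "R a \<in> carrier_mat n n" for a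
    using c by (simp add: R_def)
  define E where "E a = fmat n (R a)" for a
  define T where "T = fmul n (E x)"
  define U where "U = (\<lambda>B. fmul n B (E x))"
  define D where "D = (\<lambda>B. T B - U B)"
  have T: "fmat.endo T" and U: "fmat.endo U"
    unfolding T_def U_def by (rule endo_fmul_left endo_fmul_right)+
  have D: "fmat.endo D"
    unfolding D_def by (intro fmat.endo_diff_fun T U)
  have TU: "T (U B) = U (T B)" for B
    by (simp add: T_def U_def fmul_assoc)
  have ad: "(D ^^ j) (E a) = E ((bracket x ^^ j) a)" for j a
    using representation_ad_funpow[OF rep, of j x a] by (simp add: D_def T_def U_def E_def R_def)
  have E_add: "E (a + b) = E a + E b" for a b
  proof -
    have "R (a + b) = R a + R b"
      using rep c by (intro eq_matI) (auto simp: R_def representation_def carrier_matD[OF c])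
    then show ?thesis by (simp add: E_def fmat_add[OF R R])
  qed
  have E_scale: "E (scale r a) = fscale (to_ac r) (E a)" for r a
  proof -
    have "R (scale r a) = to_ac r \<cdot>\<^sub>m R a"
      using rep c by (intro eq_matI) (auto simp: R_def representation_def carrier_matD[OF c])
    then show ?thesis by (simp add: E_def fmat_smult[OF R])
  qed
  have mat_trace_R: "mat_trace (map_mat to_ac A) = to_ac (mat_trace A)" if "A \<in> carrier_mat n n" for A :: "'k mat"
    using that by (simp add: mat_trace_def to_ac_sum)
  have trace_E: "ftrace n (fmul n (E a) (E b)) = to_ac (mat_trace (\<rho> a * \<rho> b))" for a b
    unfolding E_def fmat_mult[OF R R, symmetric] ftrace_fmat[OF mult_carrier_mat[OF R R]]
    unfolding R_def ac.mat_hom_mult[OF c c, symmetric]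
    by (rule mat_trace_R[OF mult_carrier_mat[OF c c]])
  have trace_T: "ftrace n ((T ^^ k) (E z)) = mat_trace (R x ^\<^sub>m k * R z)" for k z
    unfolding T_def E_def fmul_funpow_fmat[OF R R]
    by (rule ftrace_fmat[OF mult_carrier_mat[OF pow_carrier_mat[OF R] R]])
  have trace_T': "ftrace n ((T ^^ k) (E z)) = to_ac (mat_trace (\<rho> x ^\<^sub>m k * \<rho> z))" for k z
    unfolding trace_T R_def ac.mat_hom_pow[OF c, symmetric] ac.mat_hom_mult[OF pow_carrier_mat[OF c] c, symmetric]
    by (rule mat_trace_R[OF mult_carrier_mat[OF pow_carrier_mat[OF c] c]])
  obtain es where es: "length es = n" "linear_factors_product (R x) es = 0\<^sub>m n n"
    "\<And>k. mat_trace (R x ^\<^sub>m k) = (\<Sum>e\<leftarrow>es. e ^ k)"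
    using eigenvalue_list_exists[OF R] by blast
  have T_zero: "fmat.poly_op T (\<Prod>e\<leftarrow>es. [:- e, 1:]) (fmat n B) = 0"
    and U_zero: "fmat.poly_op U (\<Prod>e\<leftarrow>es. [:- e, 1:]) (fmat n B) = 0"
    if "B \<in> carrier_mat n n" for B
    using poly_op_fmul_left_linear_factors[OF R[of x] that, of es] poly_op_fmul_right_linear_factors[OF R[of x] that, of es] that
    by (simp_all add: T_def U_def E_def es(2) left_mult_zero_mat[OF that] right_mult_zero_mat[OF that] fmat_zero)
  have es_zero: "e = 0" if "e \<in> set es" for e
  proof (rule ccontr)
    assume e: "e \<noteq> 0"
    \<comment> \<open>In characteristic zero the algebraic closure is a vector space over the
      rationals. The functional \<open>f\<close> takes rational values so that sums of squares are
      nonnegative.\<close>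
    have "vector_space (\<lambda>(r::rat) (y::'k alg_closure). of_rat r * y)"
      by unfold_locales (auto simp: algebra_simps of_rat_add of_rat_mult)
    from separating_functional[OF this e] obtain f :: "'k alg_closure \<Rightarrow> rat" where
      f: "\<And>y z. f (y + z) = f y + f z" "\<And>r y. f (of_rat r * y) = r * f y" "f e = 1"
      by auto
    have f_zero: "f 0 = 0"
      using f(2)[of 0 0] by simp
    have f_diff: "f (y - z) = f y - f z" for y z
      using f(1)[of "y - z" z] by simp
    define F :: "'k alg_closure \<Rightarrow> 'k alg_closure" where "F y = of_rat (f y)" for y
    have F_diff: "F (y - z) = F y - F z" for y z
      by (simp add: F_def f_diff of_rat_diff)
    \<comment> \<open>At least \<open>n\<close>, so that the product of the linear factors over
      \<open>es\<close> divides the product of the powers; at least \<open>M\<close>, so that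
      \<open>p\<close> has no terms of degree below \<open>M\<close>.\<close>
    define N where "N = max n M"
    have N: "n \<le> N" "M \<le> N" "1 \<le> N"
      using M by (auto simp: N_def)
    obtain q where q: "\<And>l. l \<in> set es \<Longrightarrow> [:- l, 1:] ^ N dvd q - [:F l:]"
      using linear_power_interpolation[of "set es" N F] by auto
    \<comment> \<open>By additivity F l - F m depends only on l - m, so a single \<open>p\<close>
      can interpolate at all differences of eigenvalues.\<close>
    have "finite ((\<lambda>(l, m). l - m) ` (set es \<times> set es))"
      by simp
    then obtain p where p: "\<And>l. l \<in> (\<lambda>(l, m). l - m) ` (set es \<times> set es) \<Longrightarrow> [:- l, 1:] ^ (N + N) dvd p - [:F l:]"
      using linear_power_interpolation[of _ "N + N" F] by meson
    \<comment> \<open>0 is one of these differences and F 0 = 0, so X^(N+N) divides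
      \<open>p\<close>.\<close>
    have p_low: "Polynomial.coeff p j = 0" if "j < M" for j
    proof -
      have "[:0, 1:] ^ (N + N) dvd p"
        using p[of 0] \<open>e \<in> set es\<close> by (force simp: F_def f_zero image_iff)
      then have "Polynomial.monom 1 (N + N) dvd p"
        by (simp add: monom_altdef)
      then show ?thesis
        using that N by (auto simp: monom_1_dvd_iff')
    qed
    have chi: "(\<Prod>e\<leftarrow>es. [:- e, 1:]) dvd (\<Prod>l\<in>set es. [:- l, 1:] ^ N)"
      using N es(1) by (intro prod_linear_dvd_power) auto
    have op_diff: "fmat.poly_op T q (E a) - fmat.poly_op U q (E a) = fmat.poly_op D p (E a)" for a
      unfolding D_def
    proof (rule fmat.poly_op_difference[OF T U TU])
      show "fmat.poly_op T (\<Prod>l\<in>set es. [:- l, 1:] ^ N) (E a) = 0"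
        using fmat.poly_op_dvd_zero[OF T chi] T_zero[OF R] by (simp add: E_def)
      show "fmat.poly_op U (\<Prod>l\<in>set es. [:- l, 1:] ^ N) (E a) = 0"
        using fmat.poly_op_dvd_zero[OF U chi] U_zero[OF R] by (simp add: E_def)
      show "[:- (l - m), 1:] ^ (N + N) dvd p - [:F l - F m:]" if "l \<in> set es" "m \<in> set es" for l m
        using p[of "l - m"] that unfolding F_diff[symmetric] by blast
    qed (use q in auto)
    define \<Phi> where "\<Phi> z = ftrace n (fmat.poly_op T q (E z))" for z
    have \<Phi>: "\<Phi> z = (\<Sum>i\<le>Polynomial.degree q. Polynomial.coeff q i * to_ac (mat_trace (\<rho> x ^\<^sub>m i * \<rho> z)))" for z
      by (simp only: \<Phi>_def ftrace_poly_op[OF T] trace_T')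
    have \<Phi>_x: "\<Phi> x = (\<Sum>l\<leftarrow>es. of_rat (f l) * l)"
    proof -
      have "R x ^\<^sub>m i * R x = R x ^\<^sub>m Suc i" for i
        by simp
      then have "\<Phi> x = (\<Sum>i\<le>Polynomial.degree q. Polynomial.coeff q i * (\<Sum>l\<leftarrow>es. l ^ Suc i))"
        by (simp only: \<Phi>_def ftrace_poly_op[OF T] trace_T es(3))
      also have "\<dots> = (\<Sum>l\<leftarrow>es. l * poly q l)"
        by (rule sum_list_poly_eq)
      also have "\<dots> = (\<Sum>l\<leftarrow>es. of_rat (f l) * l)"
      proof (rule arg_cong[of _ _ sum_list], rule map_cong[OF refl])
        fix l assume l: "l \<in> set es"
        have "[:- l, 1:] dvd [:- l, 1:] ^ N"
          by (rule dvd_power) (use N(3) in simp)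
        then have "[:- l, 1:] dvd q - [:F l:]"
          using q[OF l] by (rule dvd_trans)
        then have "poly (q - [:F l:]) l = 0"
          by (simp only: poly_eq_0_iff_dvd)
        then show "l * poly q l = of_rat (f l) * l"
          by (simp add: F_def)
      qed
      finally show ?thesis .
    qed
    have "\<Phi> x \<noteq> 0"
    proof
      \<comment> \<open>Applying \<open>f\<close> once more turns \<open>\<Phi> x\<close> into a sum
        of squares to which \<open>e\<close> contributes 1.\<close>
      have f_sum: "f (\<Sum>l\<leftarrow>ls. of_rat (f l) * l) = (\<Sum>l\<leftarrow>ls. f l * f l)" for ls
        by (induction ls) (simp_all add: f f_zero)
      have "0 \<le> (\<Sum>l\<leftarrow>ls. f l * f l)" for ls
        by (induction ls) simp_all
      moreover obtain ls1 ls2 where "es = ls1 @ e # ls2"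
        using \<open>e \<in> set es\<close> by (meson split_list)
      ultimately have "0 < (\<Sum>l\<leftarrow>es. f l * f l)"
        using f(3) by (simp add: add_nonneg_pos add_pos_nonneg)
      moreover assume "\<Phi> x = 0"
      then have "(\<Sum>l\<leftarrow>es. f l * f l) = 0"
        unfolding \<Phi>_x f_sum[symmetric] by (simp add: f_zero)
      ultimately show False by simp
    qed
    \<comment> \<open>\<open>crit\<close> concerns functionals with values in the base field, hence
      the projection \<open>\<psi>\<close>, normalised at \<open>\<Phi> x\<close> so that the
      conclusion of \<open>crit\<close> is contradicted.\<close>
    have "vector_space (\<lambda>(r::'k) y. to_ac r * y)"
      by unfold_locales (auto simp: algebra_simps)
    from separating_functional[OF this \<open>\<Phi> x \<noteq> 0\<close>] obtain \<psi> :: "'k alg_closure \<Rightarrow> 'k" where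
      \<psi>: "\<And>y z. \<psi> (y + z) = \<psi> y + \<psi> z" "\<And>r y. \<psi> (to_ac r * y) = r * \<psi> y" "\<psi> (\<Phi> x) = 1"
      by auto
    have \<psi>_zero: "\<psi> 0 = 0"
      using \<psi>(2)[of 0 0] by simp
    have \<psi>_sum: "\<psi> (\<Sum>i\<in>I. g i) = (\<Sum>i\<in>I. \<psi> (g i))" for g and I :: "nat set"
      by (induction I rule: infinite_finite_induct) (simp_all add: \<psi> \<psi>_zero)
    have "\<psi> (\<Phi> x) = 0"
    proof (rule crit[of "\<lambda>z. \<psi> (\<Phi> z)"])
      show "\<psi> (\<Phi> (z + w)) = \<psi> (\<Phi> z) + \<psi> (\<Phi> w)" for z w
        by (simp add: \<Phi>_def E_add fmat.endo_add[OF fmat.endo_poly_op[OF T]] ftrace_add \<psi>)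
      show "\<psi> (\<Phi> (scale r z)) = r * \<psi> (\<Phi> z)" for r z
        by (simp add: \<Phi>_def E_scale fmat.endo_scale[OF fmat.endo_poly_op[OF T]] ftrace_scale \<psi>)
      show "\<psi> (\<Phi> z) = 0" if "\<And>k. mat_trace (\<rho> x ^\<^sub>m k * \<rho> z) = 0" for z
        by (simp add: \<Phi> that \<psi>_zero)
      show "\<exists>c N. \<forall>z. \<psi> (\<Phi> (bracket a z)) = (\<Sum>j\<in>{M..N}. c j * mat_trace (\<rho> ((bracket x ^^ j) a) * \<rho> z))" for a
      proof (intro exI allI)
        fix z
        have E_br: "E (bracket a z) = fmul n (E a) (E z) - fmul n (E z) (E a)"
          using representation_ad_funpow[OF rep, of 1 a z] by (simp add: E_def R_def)
        \<comment> \<open>In the first product of the commutator q(T) acts on the left factor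
          \<open>E a\<close>; in the second the trace swap moves \<open>q\<close> onto
          \<open>E a\<close> as right multiplication. The difference is q(T) - q(U), which is p(D)
          on \<open>E a\<close>.\<close>
        have "\<Phi> (bracket a z) = ftrace n (fmul n (fmat.poly_op T q (E a)) (E z)) -
            ftrace n (fmul n (fmat.poly_op U q (E a)) (E z))"
          unfolding \<Phi>_def E_br fmat.endo_diff[OF fmat.endo_poly_op[OF T]] ftrace_diff
          unfolding T_def U_def poly_op_fmul_commute ftrace_fmul_swap[of n "E x" q "E z" "E a"] ..
        also have "\<dots> = ftrace n (fmul n (fmat.poly_op D p (E a)) (E z))"
          unfolding op_diff[symmetric] fmat.endo_diff[OF endo_fmul_right] ftrace_diff ..
        also have "\<dots> = (\<Sum>j\<le>Polynomial.degree p. Polynomial.coeff p j * ftrace n (fmul n (E ((bracket x ^^ j) a)) (E z)))"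
          unfolding fmat.poly_op_def fmat.endo_sum[OF endo_fmul_right] fmat.endo_scale[OF endo_fmul_right]
            ftrace_sum ftrace_scale ad ..
        finally have "\<psi> (\<Phi> (bracket a z)) =
            (\<Sum>j\<le>Polynomial.degree p. \<psi> (Polynomial.coeff p j) * mat_trace (\<rho> ((bracket x ^^ j) a) * \<rho> z))"
          by (simp add: \<psi>_sum trace_E \<psi>(2) mult.commute[of "Polynomial.coeff p _"] mult.commute[of "\<psi> _"])
        also have "\<dots> = (\<Sum>j\<in>{M..Polynomial.degree p}. \<psi> (Polynomial.coeff p j) * mat_trace (\<rho> ((bracket x ^^ j) a) * \<rho> z))"
          by (rule sum.mono_neutral_right) (auto simp: p_low \<psi>_zero)
        finally show "\<psi> (\<Phi> (bracket a z)) =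
          (\<Sum>j\<in>{M..Polynomial.degree p}. \<psi> (Polynomial.coeff p j) * mat_trace (\<rho> ((bracket x ^^ j) a) * \<rho> z))" .
      qed
    qed
    then show False using \<psi>(3) by simp
  qed
  \<comment> \<open>With all eigenvalues zero, left and right multiplication have vanishing
    \<open>n\<close>-th power on \<open>n\<close> by \<open>n\<close> matrices. The former, applied
    to the identity, makes \<open>\<rho> x\<close> nilpotent; their commuting difference makes the
    commutator operator vanish at exponent \<open>n + n\<close>.\<close>
  have "es = replicate n 0"
    using es(1) es_zero by (simp add: replicate_eqI)
  then have prod: "(\<Prod>e\<leftarrow>es. [:- e, 1:]) = [:- 0, 1:] ^ n"
    by (simp add: map_replicate prod_list_replicate)
  have T_pow: "(T ^^ n) (fmat n B) = 0" and U_pow: "(U ^^ n) (fmat n B) = 0" if "B \<in> carrier_mat n n" for B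
    using T_zero[OF that] U_zero[OF that] unfolding prod fmat.poly_op_linear_power[OF T] fmat.poly_op_linear_power[OF U]
    by simp_all
  have "fmat n (R x ^\<^sub>m n) = 0"
    using T_pow[OF one_carrier_mat] fmul_funpow_fmat[OF R[of x] one_carrier_mat, of n]
      right_mult_one_mat[OF pow_carrier_mat[OF R[of x], of n]] by (simp add: T_def E_def)
  then have "R x ^\<^sub>m n = 0\<^sub>m n n"
    by (rule fmat_eq_zero[OF pow_carrier_mat[OF R]])
  then have "map_mat to_ac (\<rho> x ^\<^sub>m n) = 0\<^sub>m n n"
    by (simp add: R_def ac.mat_hom_pow[OF c])
  moreover have inj: "A = 0\<^sub>m n n" if A: "A \<in> carrier_mat n n" and "map_mat to_ac A = 0\<^sub>m n n" for A :: "'k mat"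
  proof (rule eq_matI)
    fix i j assume "i < dim_row (0\<^sub>m n n :: 'k mat)" "j < dim_col (0\<^sub>m n n :: 'k mat)"
    then show "A $$ (i, j) = 0\<^sub>m n n $$ (i, j)"
      using arg_cong[OF that(2), of "\<lambda>A. A $$ (i, j)"] A by simp
  qed (use A in auto)
  ultimately have "\<rho> x ^\<^sub>m n = 0\<^sub>m n n"
    using pow_carrier_mat[OF c] by blast
  then show "nilpotent_mat (\<rho> x)"
    unfolding nilpotent_mat_def using c[of x] by auto
  show "\<rho> ((bracket x ^^ j) a) = 0\<^sub>m n n" if "j \<ge> n + n"
  proof -
    have "(D ^^ (n + n)) (E a) = 0"
      unfolding D_def using T_pow[OF R] U_pow[OF R] by (intro fmat.funpow_diff_eq_zero T U TU) (simp_all add: E_def)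
    moreover have "(D ^^ j) (E a) = (D ^^ (j - (n + n))) ((D ^^ (n + n)) (E a))"
      using that funpow_add[of "j - (n + n)" "n + n" D] by simp
    ultimately have "E ((bracket x ^^ j) a) = 0"
      unfolding ad[symmetric] by (simp add: fmat.endo_zero[OF fmat.endo_funpow[OF D]])
    then have "R ((bracket x ^^ j) a) = 0\<^sub>m n n"
      unfolding E_def by (rule fmat_eq_zero[OF R])
    then show ?thesis
      unfolding R_def by (rule inj[OF c])
  qed
qed

subsection \<open>Invariant forms and the theorem\<close>

text \<open>Induction on \<open>I\<close>. If \<open>g j\<close> vanishes on the common kernel of
  the others, it gets coefficient 0. Otherwise some \<open>z\<close> in that kernel has
  \<open>g j z = 1\<close>, and subtracting \<open>\<phi> z\<close> times \<open>g j\<close> from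
  \<open>\<phi>\<close> reduces to the others.\<close>

lemma functional_in_span:
  fixes scale :: "'k::field \<Rightarrow> 'a::ab_group_add \<Rightarrow> 'a" and g :: "'i \<Rightarrow> 'a \<Rightarrow> 'k"
  assumes "finite I"
    and g: "\<And>i x y. g i (x + y) = g i x + g i y" "\<And>i c x. g i (scale c x) = c * g i x"
    and "\<And>x y. \<phi> (x + y) = \<phi> x + \<phi> y" "\<And>c x. \<phi> (scale c x) = c * \<phi> x"
    and "\<And>x. (\<And>i. i \<in> I \<Longrightarrow> g i x = 0) \<Longrightarrow> \<phi> x = 0"
  shows "\<exists>c. \<forall>x. \<phi> x = (\<Sum>i\<in>I. c i * g i x)"
  using assms(1,4-)
proof (induction arbitrary: \<phi>)
  case empty
  then show ?case by simp
next
  case (insert j I)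
  note \<phi> = insert.prems(1,2)
  show ?case
  proof (cases "\<forall>x. (\<forall>i\<in>I. g i x = 0) \<longrightarrow> g j x = 0")
    case True
    then obtain c where c: "\<And>x. \<phi> x = (\<Sum>i\<in>I. c i * g i x)"
      using insert.IH[of \<phi>] insert.prems by (metis insertE)
    have "\<phi> x = (\<Sum>i\<in>insert j I. (c(j := 0)) i * g i x)" for x
      unfolding c using insert.hyps by (auto intro!: sum.cong)
    then show ?thesis by blast
  next
    case False
    then obtain y where y: "\<And>i. i \<in> I \<Longrightarrow> g i y = 0" "g j y \<noteq> 0"
      by blast
    define z where "z = scale (inverse (g j y)) y"
    have z: "\<And>i. i \<in> I \<Longrightarrow> g i z = 0" "g j z = 1"
      using y by (simp_all add: z_def g)
    have diff: "h (x - y) = h x - h y" if "\<And>x y. h (x + y) = h x + h y" for h :: "'a \<Rightarrow> 'k" and x y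
      using that[of "x - y" y] by simp
    define \<phi>' where "\<phi>' x = \<phi> x - \<phi> z * g j x" for x
    have "\<exists>c. \<forall>x. \<phi>' x = (\<Sum>i\<in>I. c i * g i x)"
    proof (rule insert.IH)
      show "\<phi>' (x + y) = \<phi>' x + \<phi>' y" for x y
        by (simp add: \<phi>'_def \<phi> g algebra_simps)
      show "\<phi>' (scale c x) = c * \<phi>' x" for c x
        by (simp add: \<phi>'_def \<phi> g algebra_simps)
      show "\<phi>' x = 0" if x: "\<And>i. i \<in> I \<Longrightarrow> g i x = 0" for x
      proof -
        have "g i (x - scale (g j x) z) = 0" if "i \<in> insert j I" for i
          using that x z by (auto simp: diff[of "g i", OF g(1)] diff[of "g j", OF g(1)] g(2))
        then have "\<phi> (x - scale (g j x) z) = 0"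
          by (rule insert.prems(3))
        then show ?thesis
          by (simp add: \<phi>'_def diff[of \<phi>, OF \<phi>(1)] \<phi>(2))
      qed
    qed
    then obtain c where c: "\<And>x. \<phi>' x = (\<Sum>i\<in>I. c i * g i x)"
      by blast
    have "\<phi> x = (\<Sum>i\<in>insert j I. (c(j := \<phi> z)) i * g i x)" for x
    proof -
      have "(\<Sum>i\<in>I. (c(j := \<phi> z)) i * g i x) = (\<Sum>i\<in>I. c i * g i x)"
        using insert.hyps by (auto intro!: sum.cong)
      then show ?thesis
        using c[of x] insert.hyps by (simp add: \<phi>'_def algebra_simps)
    qed
    then show ?thesis by blast
  qed
qed

section \<open>Bilinearity, symmetry and invariance of trace forms\<close>

context
  fixes scale :: "'k::field \<Rightarrow> 'a::ab_group_add \<Rightarrow> 'a" and bracket n \<rho>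
  assumes rep: "representation scale bracket n \<rho>"
begin

lemma trace_form_linear:
  "trace_form \<rho> (x + y) z = trace_form \<rho> x z + trace_form \<rho> y z"
  "trace_form \<rho> z (x + y) = trace_form \<rho> z x + trace_form \<rho> z y"
  "trace_form \<rho> (scale c x) z = c * trace_form \<rho> x z"
  "trace_form \<rho> z (scale c x) = c * trace_form \<rho> z x"
proof -
  have c: "\<rho> x \<in> carrier_mat n n" for x
    using rep by (simp add: representation_def)
  note m = mult_carrier_mat[OF c c]
  show "trace_form \<rho> (x + y) z = trace_form \<rho> x z + trace_form \<rho> y z"
    using rep by (simp add: representation_def trace_form_def add_mult_distrib_mat[OF c c c] mat_trace_add[OF m m])
  show "trace_form \<rho> z (x + y) = trace_form \<rho> z x + trace_form \<rho> z y"
    using rep by (simp add: representation_def trace_form_def mult_add_distrib_mat[OF c c c] mat_trace_add[OF m m])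
  show "trace_form \<rho> (scale c x) z = c * trace_form \<rho> x z" for c
    using rep by (simp add: representation_def trace_form_def mult_smult_assoc_mat[OF c c] mat_trace_smult[OF m])
  show "trace_form \<rho> z (scale c x) = c * trace_form \<rho> z x" for c
    using rep by (simp add: representation_def trace_form_def mult_smult_distrib[OF c c] mat_trace_smult[OF m])
qed

lemma trace_form_commute: "trace_form \<rho> x y = trace_form \<rho> y x"
  using rep mat_trace_comm[of "\<rho> x" n n "\<rho> y"] by (simp add: representation_def trace_form_def)

lemma trace_form_bracket: "trace_form \<rho> (bracket y a) z = trace_form \<rho> y (bracket a z)"
proof -
  have c: "\<rho> x \<in> carrier_mat n n" for x
    using rep by (simp add: representation_def)
  note m = mult_carrier_mat[OF c c]
  have "trace_form \<rho> (bracket y a) z = mat_trace (\<rho> y * \<rho> a * \<rho> z) - mat_trace (\<rho> a * \<rho> y * \<rho> z)"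
    using rep by (simp add: representation_def trace_form_def minus_mult_distrib_mat[OF m m c]
        mat_trace_diff[OF mult_carrier_mat[OF m c] mult_carrier_mat[OF m c]] del: assoc_mult_mat)
  also have "mat_trace (\<rho> a * \<rho> y * \<rho> z) = mat_trace (\<rho> y * \<rho> z * \<rho> a)"
    using mat_trace_comm[OF c m, of a y z] by (simp add: assoc_mult_mat[OF c c c])
  also have "mat_trace (\<rho> y * \<rho> a * \<rho> z) - \<dots> = trace_form \<rho> y (bracket a z)"
    using rep by (simp add: representation_def trace_form_def mult_minus_distrib_mat[OF c m m]
        mat_trace_diff[OF mult_carrier_mat[OF c m] mult_carrier_mat[OF c m]] assoc_mult_mat[OF c c c])
  finally show ?thesis .
qed

end

theorem proposition2p22:
  fixes scale :: "'k::field_char_0 \<Rightarrow> 'a::ab_group_add \<Rightarrow> 'a"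
    and bracket :: "'a \<Rightarrow> 'a \<Rightarrow> 'a"
    and Basis \<aa> \<bb> \<uu> :: "'a set"
    and \<beta> :: "'a \<Rightarrow> 'a \<Rightarrow> 'k"
  assumes "lie_algebra scale bracket"
    and "finite_dimensional_vector_space scale Basis"
    and "module.subspace scale \<aa>" and "module.subspace scale \<bb>"
    and "nilpotent_radical scale bracket \<subseteq> \<bb>" and "\<bb> \<subseteq> \<aa>"
    and "\<uu> = {x. bracket x ` \<aa> \<subseteq> \<bb>}"
    and "admissible_form scale bracket \<beta>"
  shows "\<uu> \<inter> orthogonal_space \<beta> \<uu> \<subseteq> nilpotent_cone scale bracket"
proof
  fix x assume x: "x \<in> \<uu> \<inter> orthogonal_space \<beta> \<uu>"
  interpret g: finite_dimensional_vector_space scale Basis by fact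
  obtain n \<rho> where rep: "representation scale bracket n \<rho>" and \<beta>: "\<beta> = trace_form \<rho>"
    and rad: "orthogonal_space \<beta> UNIV = nilpotent_radical scale bracket"
    using assms(8) unfolding admissible_form_def by blast
  note lin = trace_form_linear[OF rep, folded \<beta>]
  note comm = trace_form_commute[OF rep, folded \<beta>]
  note inv = trace_form_bracket[OF rep, folded \<beta>]
  have nil_iff: "z \<in> nilpotent_radical scale bracket \<longleftrightarrow> (\<forall>w. \<beta> z w = 0)" for z
    unfolding rad[symmetric] by (simp add: orthogonal_space_def)
  \<comment> \<open>The functionals \<open>\<beta> b\<close> for \<open>b\<close> in the basis have
    the radical of the form as common kernel. Admissibility identifies it with the nilpotent
    radical, so \<open>\<phi>\<close> is a combination of them.\<close>
  have represented: "\<exists>y. \<forall>z. \<phi> z = \<beta> y z"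
    if \<phi>: "\<And>z w. \<phi> (z + w) = \<phi> z + \<phi> w" "\<And>c z. \<phi> (scale c z) = c * \<phi> z"
      and \<phi>_nil: "\<And>z. z \<in> nilpotent_radical scale bracket \<Longrightarrow> \<phi> z = 0" for \<phi>
  proof -
    have "\<exists>c. \<forall>z. \<phi> z = (\<Sum>b\<in>Basis. c b * \<beta> b z)"
    proof (rule functional_in_span[where scale = scale])
      show "\<phi> z = 0" if "\<And>b. b \<in> Basis \<Longrightarrow> \<beta> b z = 0" for z
      proof (rule \<phi>_nil)
        have "\<beta> w z = 0" for w
        proof -
          have "w \<in> g.span Basis" using g.span_Basis by simp
          then show ?thesis
          proof (induction rule: g.span_induct_alt)
            case base
            show ?case using lin(3)[of 0 0 z] by simp
          next
            case (step c b w)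
            then show ?case using that by (simp add: lin)
          qed
        qed
        then show "z \<in> nilpotent_radical scale bracket"
          by (simp add: nil_iff comm[of z])
      qed
    qed (use g.finite_Basis \<phi> lin in auto)
    then obtain c where c: "\<And>z. \<phi> z = (\<Sum>b\<in>Basis. c b * \<beta> b z)"
      by blast
    have "\<beta> (\<Sum>b\<in>B. scale (c b) b) z = (\<Sum>b\<in>B. c b * \<beta> b z)" for z B
      using lin(3)[of 0 0 z] by (induction B rule: infinite_finite_induct) (simp_all add: lin)
    then show ?thesis using c by metis
  qed
  \<comment> \<open>Write \<open>\<phi>\<close> as \<open>\<beta> y\<close>. Invariance shows that
    [y, a] differs from an element of \<open>\<bb>\<close> by an element of the nilpotent radical,
    which lies in \<open>\<bb>\<close>. Hence \<open>y\<close> is in \<open>\<uu>\<close>, and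
    \<open>x\<close> is orthogonal to it.\<close>
  have vanishing: "\<phi> x = 0"
    if \<phi>: "\<And>z w. \<phi> (z + w) = \<phi> z + \<phi> w" "\<And>c z. \<phi> (scale c z) = c * \<phi> z"
      and \<phi>_nil: "\<And>z. z \<in> nilpotent_radical scale bracket \<Longrightarrow> \<phi> z = 0"
      and \<phi>_br: "\<And>a. a \<in> \<aa> \<Longrightarrow> \<exists>b\<in>\<bb>. \<forall>z. \<phi> (bracket a z) = \<beta> b z" for \<phi>
  proof -
    obtain y where y: "\<And>z. \<phi> z = \<beta> y z"
      using represented[OF \<phi> \<phi>_nil] by blast
    have "bracket y a \<in> \<bb>" if a: "a \<in> \<aa>" for a
    proof -
      obtain b where b: "b \<in> \<bb>" "\<And>z. \<phi> (bracket a z) = \<beta> b z"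
        using \<phi>_br[OF a] by blast
      have "\<beta> (bracket y a - b) z = 0" for z
        using lin(1)[of "bracket y a - b" b z] b(2)[of z] by (simp add: inv y)
      then have "bracket y a - b \<in> \<bb>"
        using nil_iff assms(5) by blast
      then show ?thesis
        using g.subspace_add[OF assms(4) _ b(1)] by force
    qed
    then have "y \<in> \<uu>"
      using assms(7) by blast
    then have "\<beta> x y = 0"
      using x by (simp add: orthogonal_space_def)
    then show ?thesis
      using y comm by simp
  qed
  \<comment> \<open>\<open>x\<close> maps \<open>\<aa>\<close> into \<open>\<bb>\<close>, which lies
    in \<open>\<aa>\<close>. The bound on \<open>j\<close> is there because \<open>a\<close> itself
    may lie outside \<open>\<bb>\<close>.\<close>
  have ad_\<bb>: "(bracket x ^^ j) a \<in> \<bb>" if "a \<in> \<aa>" "1 \<le> j" for a j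
    using that(2)
  proof (induction j rule: dec_induct)
    case base
    then show ?case using x assms(7) that(1) by auto
  next
    case (step j)
    then show ?case using x assms(6,7) by auto
  qed
  \<comment> \<open>The criterion for the representation \<open>\<rho>\<close> defining the form,
    with order 1, shows that \<open>\<rho>\<close> kills these elements; they are then orthogonal to
    everything.\<close>
  have nil: "(bracket x ^^ j) a \<in> nilpotent_radical scale bracket" if "j \<ge> n + n" for j a
  proof -
    have "\<rho> ((bracket x ^^ j) a) = 0\<^sub>m n n"
    proof (rule trace_functional_criterion(2)[OF rep order_refl[of 1] _ that])
      fix \<phi> :: "'a \<Rightarrow> 'k"
      assume \<phi>: "\<And>z w. \<phi> (z + w) = \<phi> z + \<phi> w" "\<And>c z. \<phi> (scale c z) = c * \<phi> z"
        and \<phi>_tr: "\<And>z. (\<And>k. mat_trace (\<rho> x ^\<^sub>m k * \<rho> z) = 0) \<Longrightarrow> \<phi> z = 0"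
        and \<phi>_br: "\<And>a. \<exists>c N. \<forall>z. \<phi> (bracket a z) = (\<Sum>j\<in>{1..N}. c j * mat_trace (\<rho> ((bracket x ^^ j) a) * \<rho> z))"
      show "\<phi> x = 0"
      proof (rule vanishing[OF \<phi>])
        show "\<phi> z = 0" if "z \<in> nilpotent_radical scale bracket" for z
          by (rule \<phi>_tr) (rule trace_nilpotent_radical[OF rep that])
        show "\<exists>b\<in>\<bb>. \<forall>z. \<phi> (bracket a z) = \<beta> b z" if a: "a \<in> \<aa>" for a
        proof -
          obtain c N where c: "\<And>z. \<phi> (bracket a z) = (\<Sum>j\<in>{1..N}. c j * mat_trace (\<rho> ((bracket x ^^ j) a) * \<rho> z))"
            using \<phi>_br by blast
          let ?b = "\<Sum>j\<in>{1..N}. scale (c j) ((bracket x ^^ j) a)"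
          have "?b \<in> \<bb>"
            by (intro g.subspace_sum g.subspace_scale assms(4) ad_\<bb> a) simp
          moreover have "\<beta> (\<Sum>j\<in>J. scale (c j) ((bracket x ^^ j) a)) z =
              (\<Sum>j\<in>J. c j * \<beta> ((bracket x ^^ j) a) z)" for z J
            using lin(3)[of 0 0 z] by (induction J rule: infinite_finite_induct) (simp_all add: lin)
          ultimately show ?thesis
            using c by (intro bexI[of _ ?b]) (simp_all add: \<beta> trace_form_def)
        qed
      qed
    qed
    moreover have c: "\<rho> z \<in> carrier_mat n n" for z
      using rep by (simp add: representation_def)
    ultimately show ?thesis
      by (simp add: nil_iff \<beta> trace_form_def left_mult_zero_mat[OF c])
  qed
  \<comment> \<open>For arbitrary \<open>\<sigma>\<close> the order is raised past
    \<open>n + n\<close>, so only elements of the nilpotent radical occur in the sum. Their traces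
    vanish, \<open>\<phi>\<close> kills all brackets, and 0 serves as the element of
    \<open>\<bb>\<close>. The \<open>Suc\<close> keeps the order positive when \<open>n\<close> is
    0.\<close>
  have "nilpotent_mat (\<sigma> x)" if \<sigma>: "representation scale bracket m \<sigma>" for m \<sigma>
  proof (rule trace_functional_criterion(1)[OF \<sigma>, of "Suc (n + n)"])
    fix \<phi> :: "'a \<Rightarrow> 'k"
    assume \<phi>: "\<And>z w. \<phi> (z + w) = \<phi> z + \<phi> w" "\<And>c z. \<phi> (scale c z) = c * \<phi> z"
      and \<phi>_tr: "\<And>z. (\<And>k. mat_trace (\<sigma> x ^\<^sub>m k * \<sigma> z) = 0) \<Longrightarrow> \<phi> z = 0"
      and \<phi>_br: "\<And>a. \<exists>c N. \<forall>z. \<phi> (bracket a z) =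
        (\<Sum>j\<in>{Suc (n + n)..N}. c j * mat_trace (\<sigma> ((bracket x ^^ j) a) * \<sigma> z))"
    show "\<phi> x = 0"
    proof (rule vanishing[OF \<phi>])
      show "\<phi> z = 0" if "z \<in> nilpotent_radical scale bracket" for z
        by (rule \<phi>_tr) (rule trace_nilpotent_radical[OF \<sigma> that])
      show "\<exists>b\<in>\<bb>. \<forall>z. \<phi> (bracket a z) = \<beta> b z" for a
      proof -
        have "mat_trace (\<sigma> ((bracket x ^^ j) a) * \<sigma> z) = 0" if "j \<ge> Suc (n + n)" for j z
        proof -
          have c: "\<sigma> w \<in> carrier_mat m m" for w
            using \<sigma> by (simp add: representation_def)
          \<comment> \<open>Exponent 1, with \<open>z\<close> in place of \<open>x\<close>, gives
            the trace form of \<open>\<sigma>\<close> up to the order of the factors.\<close>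
          have "mat_trace (\<sigma> z ^\<^sub>m 1 * \<sigma> ((bracket x ^^ j) a)) = 0"
            by (rule trace_nilpotent_radical[OF \<sigma> nil]) (use that in simp)
          then show ?thesis
            using mat_trace_comm[OF c c, of z "(bracket x ^^ j) a"] left_mult_one_mat[OF c, of z] c[of z]
            by simp
        qed
        then have "\<phi> (bracket a z) = 0" for z
          using \<phi>_br[of a] by force
        moreover have "\<beta> 0 z = 0" for z
          using lin(3)[of 0 0 z] by simp
        ultimately show ?thesis
          using g.subspace_0[OF assms(4)] by force
      qed
    qed
  qed simp
  then show "x \<in> nilpotent_cone scale bracket"
    by (simp add: nilpotent_cone_def)
qed

end
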